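(* Let $X$ and $Y$ be shape path connected topological spaces with $\mathrm{HPol}$-expansions $\mathbf{p}:X\to\mathbf{X}$ and $\mathbf{q}:Y\to\mathbf{Y}$ such that $\mathbf{p}\times\mathbf{q}:X\times Y\to\mathbf{X}\times\mathbf{Y}$ is an $\mathrm{HPol}$-expansion of $X\times Y$. Then for every integer $k\ge1$ (and any base points $x\in X$, $y\in Y$), $$\check{\pi}_k^{top}(X\times Y,(x,y))\cong\check{\pi}_k^{top}(X,x)\times\check{\pi}_k^{top}(Y,y)$$ as topological groups.
   Context: $\mathrm{HTop}$ (resp. $\mathrm{HTop}_*$) is the homotopy category of topological spaces (resp. pointed spaces); $\mathrm{HPol}$ (resp. $\mathrm{HPol}_*$) is its full subcategory of spaces having the (pointed) homotopy type of a (pointed) polyhedron. Inverse systems are indexed by directed sets. An $\mathrm{HPol}$-expansion of $X$ is an inverse system $\mathbf{X}=(X_\lambda,p_{\lambda\lambda'},\Lambda)$ in $\mathrm{HPol}$ with a morphism $\mathbf{p}=(p_\lambda):X\to\mathbf{X}$ of pro-$\mathrm{HTop}$ (so $p_{\lambda\lambda'}p_{\lambda'}=p_\lambda$ in $\mathrm{HTop}$) such that: (E1) for every $P\in\mathrm{HPol}$ and $h:X\to P$ in $\mathrm{HTop}$ there are $\lambda\in\Lambda$ and $f:X_\lambda\to P$ with $fp_\lambda= h$ in $\mathrm{HTop}$; (E2) if $f_0,f_1:X_\lambda\to P$ satisfy $f_0p_\lambda= f_1p_\lambda$, then $f_0p_{\lambda\lambda'}= f_1p_{\lambda\lambda'}$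 for some $\lambda'\ge\lambda$. $\mathrm{HPol}_*$-expansions of pointed spaces are defined in the same way with pointed maps and pointed homotopies; every (pointed) space has an expansion. For $\mathbf{X}=(X_\lambda,p_{\lambda\lambda'},\Lambda)$ and $\mathbf{Y}=(Y_\mu,q_{\mu\mu'},M)$, $\mathbf{X}\times\mathbf{Y}$ is the system $(X_\lambda\times Y_\mu,p_{\lambda\lambda'}\times q_{\mu\mu'},\Lambda\times M)$ and $\mathbf{p}\times\mathbf{q}=(p_\lambda\times q_\mu)$. Shape morphisms between (pointed, bi-pointed) spaces are represented by morphisms in the corresponding pro-homotopy category between expansions, with representatives for different expansions identified via the canonical isomorphisms. A space $X$ is shape path connected if for any two points $x,x'\in X$ there is a shape path from $x$ to $x'$, i.e. a bi-pointed shape morphism $([0,1],0,1)\to(X,x,x')$ (shape morphism in the category of spaces with two distinguished points, using bi-pointed polyhedra). For a pointed space $(X,x)$ with an $\mathrm{HPol}_*$-expansion $((X_\lambda,x_\lambda),p_{\lambda\lambda'},\Lambda)$, a shape morphism $F:(S^k,* )\to(X,x)$ is a family $(f_\lambda)$ of pointed homotopy classes $f_\lambda:(S^k,* )\to(X_\lambda,x_\lambda)$ with $p_{\lambda\lambda'}f_{\lambda'}=f_\lambda$, and $p_\lambda\circ F=f_\lambda$. The $k$th shape group $\check{\pi}_k(X,x)=Sh((S^k,* ),(X,x))$ is the set of these with operation $F+G$ represented by $(f_\lambda+g_\lambda)_\lambda$ (product in $\pi_k(X_\lambda,x_\lambda)$). $\check{\pi}_k^{top}(X,x)$ is this group with the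 topology having as basis the sets $V_\lambda^F=\{G : p_\lambda\circ F=p_\lambda\circ G \text{ as pointed homotopy classes to } X_\lambda\}$. It is a topological group and does not depend on the choice of expansion. *)

theory Defs
  imports "HOL-Analysis.Analysis" "HOL-Algebra.Group"
begin

text \<open>
  A space with distinguished points is a topology together with a list of points: the empty list
  is the unpointed case, one point the pointed case, two points the bi-pointed case.  Thus HTop,
  pointed HTop, bi-pointed HTop and their polyhedral subcategories are treated uniformly.

  Morphisms of HTop are handled through representing functions, and equality of morphisms is
  homotopy.  Only in the shape groups, where equality of elements matters, are actual homotopy
  classes used.
\<close>

definition based_map ::
  "'a topology \<Rightarrow> 'a list \<Rightarrow> 'b topology \<Rightarrow> 'b list \<Rightarrow> ('a \<Rightarrow> 'b) \<Rightarrow> bool" where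
  "based_map X xs Y ys f \<longleftrightarrow> continuous_map X Y f \<and> map f xs = ys"

definition based_homotopic ::
  "'a topology \<Rightarrow> 'a list \<Rightarrow> 'b topology \<Rightarrow> 'b list \<Rightarrow> ('a \<Rightarrow> 'b) \<Rightarrow> ('a \<Rightarrow> 'b) \<Rightarrow> bool" where
  "based_homotopic X xs Y ys f g \<longleftrightarrow> homotopic_with (\<lambda>h. map h xs = ys) X Y f g"

definition based_homotopy_equivalent ::
  "'a topology \<Rightarrow> 'a list \<Rightarrow> 'b topology \<Rightarrow> 'b list \<Rightarrow> bool" where
  "based_homotopy_equivalent X xs Y ys \<longleftrightarrow>
     (\<exists>f g. based_map X xs Y ys f \<and> based_map Y ys X xs g \<and>
            based_homotopic X xs X xs (g \<circ> f) id \<and> based_homotopic Y ys Y ys (f \<circ> g) id)"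

lemma based_homotopy_equivalent_Nil:
  "based_homotopy_equivalent X [] Y [] \<longleftrightarrow> X homotopy_equivalent_space Y"
  by (simp add: based_homotopy_equivalent_def based_map_def based_homotopic_def
      homotopy_equivalent_space_def)

text \<open>Polyhedra: geometric realizations of abstract simplicial complexes with the weak topology.\<close>

definition abstract_complex :: "'v set set \<Rightarrow> bool" where
  "abstract_complex K \<longleftrightarrow>
     (\<forall>s\<in>K. finite s \<and> s \<noteq> {}) \<and> (\<forall>s\<in>K. \<forall>t. t \<noteq> {} \<and> t \<subseteq> s \<longrightarrow> t \<in> K)"

definition closed_simplex :: "'v set \<Rightarrow> ('v \<Rightarrow> real) set" where
  "closed_simplex s = {t. (\<forall>v. 0 \<le> t v) \<and> (\<forall>v. v \<notin> s \<longrightarrow> t v = 0) \<and> (\<Sum>v\<in>s. t v) = 1}"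

text \<open>
  For finite \<open>s\<close> the topology of pointwise convergence on \<open>closed_simplex s\<close>, which is the one
  given by \<open>top_of_set\<close> below, is the Euclidean one.
\<close>

definition polyhedron :: "'v set set \<Rightarrow> ('v \<Rightarrow> real) topology" where
  "polyhedron K = topology (\<lambda>U. U \<subseteq> (\<Union>s\<in>K. closed_simplex s) \<and>
     (\<forall>s\<in>K. openin (top_of_set (closed_simplex s)) (U \<inter> closed_simplex s)))"

lemma openin_polyhedron:
  "openin (polyhedron K) U \<longleftrightarrow> U \<subseteq> (\<Union>s\<in>K. closed_simplex s) \<and>
     (\<forall>s\<in>K. openin (top_of_set (closed_simplex s)) (U \<inter> closed_simplex s))"
proof -
  have "istopology (\<lambda>U. U \<subseteq> (\<Union>s\<in>K. closed_simplex s) \<and>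
     (\<forall>s\<in>K. openin (top_of_set (closed_simplex s)) (U \<inter> closed_simplex s)))"
    unfolding istopology_def
  proof (intro conjI allI impI ballI)
    fix S T s
    assume S: "S \<subseteq> (\<Union>s\<in>K. closed_simplex s) \<and>
       (\<forall>s\<in>K. openin (top_of_set (closed_simplex s)) (S \<inter> closed_simplex s))"
      and T: "T \<subseteq> (\<Union>s\<in>K. closed_simplex s) \<and>
       (\<forall>s\<in>K. openin (top_of_set (closed_simplex s)) (T \<inter> closed_simplex s))"
    show "S \<inter> T \<subseteq> (\<Union>s\<in>K. closed_simplex s)"
      using S by blast
    assume "s \<in> K"
    moreover have "S \<inter> T \<inter> closed_simplex s = (S \<inter> closed_simplex s) \<inter> (T \<inter> closed_simplex s)"
      by blast
    ultimately show "openin (top_of_set (closed_simplex s)) (S \<inter> T \<inter> closed_simplex s)"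
      using S T by (metis openin_Int)
  next
    fix \<U> s
    assume U: "\<forall>U\<in>\<U>. U \<subseteq> (\<Union>s\<in>K. closed_simplex s) \<and>
       (\<forall>s\<in>K. openin (top_of_set (closed_simplex s)) (U \<inter> closed_simplex s))"
    show "\<Union>\<U> \<subseteq> (\<Union>s\<in>K. closed_simplex s)"
      using U by blast
    assume "s \<in> K"
    moreover have "\<Union>\<U> \<inter> closed_simplex s = (\<Union>U\<in>\<U>. U \<inter> closed_simplex s)"
      by blast
    ultimately show "openin (top_of_set (closed_simplex s)) (\<Union>\<U> \<inter> closed_simplex s)"
      using U by (metis (no_types, lifting) openin_Union imageE)
  qed
  then show ?thesis
    by (simp add: polyhedron_def topology_inverse')
qed

text \<open>
  HOL cannot quantify over the class of all polyhedra inside a formula, so a type \<open>'u\<close> plays the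
  role of the universe: the objects of HPol (pointed HPol, bi-pointed HPol) have the homotopy type
  of polyhedra whose vertices lie in \<open>'u\<close>, and the test objects P in (E1) and (E2) have their points
  in \<open>'u\<close>.  If \<open>'u\<close> has at least the cardinality of the continuum and that of the space expanded,
  this is no restriction on (E1) and (E2): the map h, respectively a homotopy from \<open>f0 p\<close> to
  \<open>f1 p\<close> and the maps \<open>f0\<close>, \<open>f1\<close> (after replacing their source, up to homotopy, by a polyhedron
  with vertices in \<open>'u\<close>), have their image in a subpolyhedron of P with at most as many points
  as \<open>'u\<close>.
\<close>

definition HPol :: "'u itself \<Rightarrow> 'p topology \<Rightarrow> 'p list \<Rightarrow> bool" where
  "HPol _ P ps \<longleftrightarrow>
     (\<exists>(K :: 'u set set) bs. abstract_complex K \<and> set bs \<subseteq> topspace (polyhedron K) \<and>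
        length bs = length ps \<and> based_homotopy_equivalent P ps (polyhedron K) bs)"

record ('i, 'p) inv_sys =
  index :: "'i set"
  leq :: "'i \<Rightarrow> 'i \<Rightarrow> bool"
  obj :: "'i \<Rightarrow> 'p topology"
  pts :: "'i \<Rightarrow> 'p list"
  bond :: "'i \<Rightarrow> 'i \<Rightarrow> 'p \<Rightarrow> 'p"

definition directed_set :: "'i set \<Rightarrow> ('i \<Rightarrow> 'i \<Rightarrow> bool) \<Rightarrow> bool" where
  "directed_set I R \<longleftrightarrow> I \<noteq> {} \<and> (\<forall>i\<in>I. R i i) \<and>
     (\<forall>i\<in>I. \<forall>j\<in>I. \<forall>k\<in>I. R i j \<and> R j k \<longrightarrow> R i k) \<and>
     (\<forall>i\<in>I. \<forall>j\<in>I. \<exists>k\<in>I. R i k \<and> R j k)"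

text \<open>
  \<open>bond S i j\<close> (for \<open>i \<le> j\<close>) represents the bonding morphism from the \<open>j\<close>-th to the \<open>i\<close>-th term.
\<close>

definition inverse_system :: "'u itself \<Rightarrow> ('i, 'p) inv_sys \<Rightarrow> bool" where
  "inverse_system U S \<longleftrightarrow>
     directed_set (index S) (leq S) \<and>
     (\<forall>i\<in>index S. HPol U (obj S i) (pts S i)) \<and>
     (\<forall>i\<in>index S. \<forall>j\<in>index S. leq S i j \<longrightarrow>
        based_map (obj S j) (pts S j) (obj S i) (pts S i) (bond S i j)) \<and>
     (\<forall>i\<in>index S. based_homotopic (obj S i) (pts S i) (obj S i) (pts S i) (bond S i i) id) \<and>
     (\<forall>i\<in>index S. \<forall>j\<in>index S. \<forall>k\<in>index S. leq S i j \<and> leq S j k \<longrightarrow>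
        based_homotopic (obj S k) (pts S k) (obj S i) (pts S i)
          (bond S i j \<circ> bond S j k) (bond S i k))"

definition pro_map ::
  "'a topology \<Rightarrow> 'a list \<Rightarrow> ('i, 'p) inv_sys \<Rightarrow> ('i \<Rightarrow> 'a \<Rightarrow> 'p) \<Rightarrow> bool" where
  "pro_map X xs S p \<longleftrightarrow>
     (\<forall>i\<in>index S. based_map X xs (obj S i) (pts S i) (p i)) \<and>
     (\<forall>i\<in>index S. \<forall>j\<in>index S. leq S i j \<longrightarrow>
        based_homotopic X xs (obj S i) (pts S i) (bond S i j \<circ> p j) (p i))"

definition HPol_expansion ::
  "'u itself \<Rightarrow> 'a topology \<Rightarrow> 'a list \<Rightarrow> ('i, 'p) inv_sys \<Rightarrow> ('i \<Rightarrow> 'a \<Rightarrow> 'p) \<Rightarrow> bool" where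
  "HPol_expansion U X xs S p \<longleftrightarrow>
     inverse_system U S \<and> pro_map X xs S p \<and>
     \<comment> \<open>(E1)\<close>
     (\<forall>(P :: 'u topology) ps h. HPol U P ps \<and> based_map X xs P ps h \<longrightarrow>
        (\<exists>i\<in>index S. \<exists>f. based_map (obj S i) (pts S i) P ps f \<and>
           based_homotopic X xs P ps (f \<circ> p i) h)) \<and>
     \<comment> \<open>(E2)\<close>
     (\<forall>(P :: 'u topology) ps. \<forall>i\<in>index S. \<forall>f0 f1. HPol U P ps \<and>
        based_map (obj S i) (pts S i) P ps f0 \<and> based_map (obj S i) (pts S i) P ps f1 \<and>
        based_homotopic X xs P ps (f0 \<circ> p i) (f1 \<circ> p i) \<longrightarrow>
        (\<exists>j\<in>index S. leq S i j \<and>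
           based_homotopic (obj S j) (pts S j) P ps (f0 \<circ> bond S i j) (f1 \<circ> bond S i j)))"

definition prod_sys :: "('i, 'p) inv_sys \<Rightarrow> ('j, 'q) inv_sys \<Rightarrow> ('i \<times> 'j, 'p \<times> 'q) inv_sys" where
  "prod_sys S T =
     \<lparr>index = index S \<times> index T,
      leq = (\<lambda>(i, j) (i', j'). leq S i i' \<and> leq T j j'),
      obj = (\<lambda>(i, j). prod_topology (obj S i) (obj T j)),
      pts = (\<lambda>(i, j). zip (pts S i) (pts T j)),
      bond = (\<lambda>(i, j) (i', j'). map_prod (bond S i i') (bond T j j'))\<rparr>"

definition prod_pro_map :: "('i \<Rightarrow> 'a \<Rightarrow> 'p) \<Rightarrow> ('j \<Rightarrow> 'b \<Rightarrow> 'q) \<Rightarrow> 'i \<times> 'j \<Rightarrow> 'a \<times> 'b \<Rightarrow> 'p \<times> 'q" where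
  "prod_pro_map p q = (\<lambda>(i, j). map_prod (p i) (q j))"

definition homotopy_class ::
  "'a topology \<Rightarrow> 'a list \<Rightarrow> 'b topology \<Rightarrow> 'b list \<Rightarrow> ('a \<Rightarrow> 'b) \<Rightarrow> ('a \<Rightarrow> 'b) set" where
  "homotopy_class X xs Y ys f = {g. based_homotopic X xs Y ys f g}"

text \<open>
  Shape morphisms into a space with expansion \<open>S\<close> from a polyhedron \<open>Q\<close> (the sphere or the
  interval), which is its own expansion: compatible families of homotopy classes.
\<close>

definition shape_morphisms ::
  "'s topology \<Rightarrow> 's list \<Rightarrow> ('i, 'p) inv_sys \<Rightarrow> ('i \<Rightarrow> ('s \<Rightarrow> 'p) set) set" where
  "shape_morphisms Q qs S =
     {F \<in> (\<Pi>\<^sub>E i\<in>index S. homotopy_class Q qs (obj S i) (pts S i) `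
                          {f. based_map Q qs (obj S i) (pts S i) f}).
      \<forall>i\<in>index S. \<forall>j\<in>index S. leq S i j \<longrightarrow> (\<forall>f\<in>F j. bond S i j \<circ> f \<in> F i)}"

definition shape_path_connected :: "'u topology \<Rightarrow> bool" where
  "shape_path_connected X \<longleftrightarrow>
     (\<forall>x\<in>topspace X. \<forall>x'\<in>topspace X.
        \<exists>(S :: ('u, 'u) inv_sys) p. HPol_expansion TYPE('u) X [x, x'] S p \<and>
          shape_morphisms (top_of_set {0..1::real}) [0, 1] S \<noteq> {})"

definition sphere_base :: "nat \<Rightarrow> real" where
  "sphere_base = (\<lambda>i. if i = 0 then 1 else 0)"

text \<open>
  For \<open>k \<ge> 1\<close>, \<open>sphere_pinch k\<close> maps \<open>nsphere k\<close> to itself, sends the equator \<open>x k = 0\<close> (which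
  contains \<open>sphere_base\<close>) to \<open>sphere_base\<close>, and each of the two open hemispheres homeomorphically,
  with degree 1, onto the complement of \<open>sphere_base\<close>: it doubles the angular distance from the
  pole of the hemisphere and then rotates the image of the equator to \<open>sphere_base\<close>.
  So \<open>sphere_add k f g\<close> is the composition of the usual comultiplication of the sphere, the map
  to the wedge of two spheres collapsing the equator, with the map given by \<open>f\<close> and \<open>g\<close>.
  For \<open>k = 1\<close>, \<open>sphere_pinch\<close> doubles the angle and \<open>sphere_add\<close> is concatenation of loops.
\<close>

definition sphere_pinch :: "nat \<Rightarrow> (nat \<Rightarrow> real) \<Rightarrow> nat \<Rightarrow> real" where
  "sphere_pinch k x =
     (\<lambda>i. if i = 0 then 1 - 2 * (x k)\<^sup>2
          else if i = k then 2 * x k * x 0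
          else 2 * \<bar>x k\<bar> * x i)"

lemma sphere_pinch_in_nsphere:
  assumes "k \<ge> 1" "x \<in> topspace (nsphere k)"
  shows "sphere_pinch k x \<in> topspace (nsphere k)"
proof -
  have sq: "(\<Sum>i\<le>k. (z i)\<^sup>2) = (z 0)\<^sup>2 + (z k)\<^sup>2 + (\<Sum>i\<in>{0<..<k}. (z i)\<^sup>2)" for z :: "nat \<Rightarrow> real"
  proof -
    have "{..k} = insert 0 (insert k {0<..<k})"
      using assms(1) by auto
    then show ?thesis
      using assms(1) by simp
  qed
  define r where "r = (\<Sum>i\<in>{0<..<k}. (x i)\<^sup>2)"
  have x: "\<And>i. i > k \<Longrightarrow> x i = 0" "(x 0)\<^sup>2 + (x k)\<^sup>2 + r = 1"
    using assms(2) sq[of x] by (auto simp: nsphere r_def)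
  have "(\<Sum>i\<in>{0<..<k}. (sphere_pinch k x i)\<^sup>2) = 4 * (x k)\<^sup>2 * r"
    by (auto simp: sphere_pinch_def r_def sum_distrib_left power_mult_distrib intro!: sum.cong)
  then have "(\<Sum>i\<le>k. (sphere_pinch k x i)\<^sup>2)
      = (1 - 2 * (x k)\<^sup>2)\<^sup>2 + (2 * x k * x 0)\<^sup>2 + 4 * (x k)\<^sup>2 * r"
    using assms(1) unfolding sq by (simp add: sphere_pinch_def)
  also have "\<dots> = 1 - 4 * (x k)\<^sup>2 * (1 - ((x 0)\<^sup>2 + (x k)\<^sup>2 + r))"
    by (simp add: power2_eq_square algebra_simps)
  finally have "(\<Sum>i\<le>k. (sphere_pinch k x i)\<^sup>2) = 1"
    by (simp add: x(2))
  moreover have "\<And>i. i > k \<Longrightarrow> sphere_pinch k x i = 0"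
    using x(1) assms(1) by (simp add: sphere_pinch_def)
  ultimately show ?thesis
    by (simp add: nsphere)
qed

definition sphere_add ::
  "nat \<Rightarrow> ((nat \<Rightarrow> real) \<Rightarrow> 'p) \<Rightarrow> ((nat \<Rightarrow> real) \<Rightarrow> 'p) \<Rightarrow> (nat \<Rightarrow> real) \<Rightarrow> 'p" where
  "sphere_add k f g = (\<lambda>x. if 0 \<le> x k then f (sphere_pinch k x) else g (sphere_pinch k x))"

definition shape_group ::
  "nat \<Rightarrow> ('i, 'p) inv_sys \<Rightarrow> ('i \<Rightarrow> ((nat \<Rightarrow> real) \<Rightarrow> 'p) set) monoid" where
  "shape_group k S =
     \<lparr>carrier = shape_morphisms (nsphere k) [sphere_base] S,
      mult = (\<lambda>F G. \<lambda>i\<in>index S. \<Union>f\<in>F i. \<Union>g\<in>G i.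
         homotopy_class (nsphere k) [sphere_base] (obj S i) (pts S i) (sphere_add k f g)),
      one = (\<lambda>i\<in>index S. homotopy_class (nsphere k) [sphere_base] (obj S i) (pts S i)
         (\<lambda>_. hd (pts S i)))\<rparr>"

text \<open>The sets generating the topology form a basis, because the index set is directed.\<close>

definition shape_group_topology ::
  "nat \<Rightarrow> ('i, 'p) inv_sys \<Rightarrow> ('i \<Rightarrow> ((nat \<Rightarrow> real) \<Rightarrow> 'p) set) topology" where
  "shape_group_topology k S =
     topology_generated_by
       {{G \<in> carrier (shape_group k S). F i = G i} |i F.
          i \<in> index S \<and> F \<in> carrier (shape_group k S)}"

definition topological_group_isomorphic ::
  "'a monoid \<Rightarrow> 'a topology \<Rightarrow> 'b monoid \<Rightarrow> 'b topology \<Rightarrow> bool" where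
  "topological_group_isomorphic G TG H TH \<longleftrightarrow> (\<exists>\<phi>\<in>iso G H. homeomorphic_map TG TH \<phi>)"

end

theory Submission
  imports Defs
begin

text \<open>
  The isomorphism is induced by the two projections.  It is onto because of the inclusions
  \<open>X \<rightarrow> X \<times> Y\<close> and \<open>Y \<rightarrow> X \<times> Y\<close> at the base points: \<open>(G, H)\<close> is the image of the product of
  the images of \<open>G\<close> and \<open>H\<close>.  It is injective and open because every pointed map from
  \<open>X \<times> Y\<close> to a polyhedron factors, up to pointed homotopy, through some \<open>a l \<times> b m\<close>, so that each
  component of a shape morphism into \<open>X \<times> Y\<close> can be read off from finitely many components of its
  projections.  The given expansion of the product yields such a factorization up to free homotopy;
  the trace of the base point is corrected by a self-map of the polyhedron, all of whose points are
  strong neighbourhood deformation retracts.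
\<close>

section \<open>Correcting the base point of a free homotopy\<close>

text \<open>The hypothesis concerns unpointed expansions \<open>XX\<close> and \<open>YY\<close>,
  while the groups are formed from pointed expansions \<open>A\<close>, \<open>B\<close>,
  \<open>C\<close> that are unrelated to them and to each other. A self-map of the target, on the
  other hand, composed after a map that factors through \<open>map_prod (a l) (b m)\<close>, leaves
  that factorization intact. This is why \<open>homotopy_end_rel_point\<close> changes only the
  start of a homotopy, and only by postcomposition. For products just the existence of a
  factorization is established; different factorizations are compared inside the expansion
  \<open>C\<close> of the product, where (E2) is at hand. The group law enters through additivity of
  postcomposition and through the unit law, for which an explicit homotopy on the sphere is given. A
  second obstacle is one of size: (E1) and (E2) test only spaces with points in the universe, but
  the terms of expansions have arbitrary types, so their polyhedra are first copied into the
  universe.\<close>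

abbreviation I01 :: "real topology" where "I01 \<equiv> top_of_set {0..1}"

text \<open>Well-pointedness as a strong deformation retraction: the open neighbourhood
  \<open>\<eta> < 1\<close> of \<open>b\<close> is contracted to \<open>b\<close> by a homotopy of
  the whole of \<open>K\<close> that fixes \<open>b\<close>.\<close>

definition NDR_point :: "'a topology \<Rightarrow> 'a \<Rightarrow> bool" where
  "NDR_point K b \<longleftrightarrow> b \<in> topspace K \<and>
     (\<exists>\<Phi> \<eta>. continuous_map (prod_topology I01 K) K \<Phi> \<and> continuous_map K I01 \<eta> \<and>
        (\<forall>t\<in>topspace K. \<Phi> (0, t) = t) \<and> (\<forall>s\<in>{0..1}. \<Phi> (s, b) = b) \<and> \<eta> b = 0 \<and>
        (\<forall>t\<in>topspace K. \<Phi> (1, t) = b \<or> \<eta> t = 1))"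

lemma continuous_map_pair_compose:
  assumes "continuous_map (prod_topology P Q) T A" "continuous_map X P f" "continuous_map X Q g"
  shows "continuous_map X T (\<lambda>x. A (f x, g x))"
proof -
  have "continuous_map X (prod_topology P Q) (\<lambda>x. (f x, g x))"
    using assms(2,3) by (simp add: continuous_map_pairedI)
  from continuous_map_compose[OF this assms(1)] show ?thesis by (simp add: o_def)
qed

lemma continuous_map_I01:
  "continuous_map X I01 f \<longleftrightarrow> continuous_map X euclideanreal f \<and> (\<forall>x\<in>topspace X. 0 \<le> f x \<and> f x \<le> 1)"
  by (auto simp: continuous_map_in_subtopology)

lemma homotopic_withI:
  assumes "continuous_map (prod_topology I01 X) Y H"
    and "\<And>h k. (\<And>x. x \<in> topspace X \<Longrightarrow> h x = k x) \<Longrightarrow> P h \<longleftrightarrow> P k"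
    and "\<And>x. x \<in> topspace X \<Longrightarrow> H (0, x) = f x" "\<And>x. x \<in> topspace X \<Longrightarrow> H (1, x) = g x"
    and "\<And>t. t \<in> {0..1} \<Longrightarrow> P (\<lambda>x. H (t, x))"
  shows "homotopic_with P X Y f g"
proof (subst homotopic_with)
  show "(\<And>x. x \<in> topspace X \<Longrightarrow> h x = k x) \<Longrightarrow> P h \<longleftrightarrow> P k" for h k
    by (rule assms(2))
  show "\<exists>h. continuous_map (prod_topology I01 X) Y h \<and> (\<forall>x\<in>topspace X. h (0, x) = f x) \<and>
      (\<forall>x\<in>topspace X. h (1, x) = g x) \<and> (\<forall>t\<in>{0..1}. P (\<lambda>x. h (t, x)))"
    using assms(1,3,4,5) by (intro exI[of _ H] conjI ballI)
qed

text \<open>First \<open>\<Phi>\<close> moves \<open>x\<close> at time 0, then the time rises from 0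
  to \<open>\<eta> x\<close>; the value at \<open>m\<close> is constant since \<open>\<Phi>\<close>
  fixes \<open>m\<close> and \<open>\<eta> m = 0\<close>. When \<open>\<Phi>\<close> and
  \<open>\<eta>\<close> witness \<open>NDR_point M m\<close>, the final pair
  \<open>(\<eta> x, \<Phi> (1, x))\<close> lies over the point \<open>m\<close> or has time
  1.\<close>

lemma NDR_slide:
  assumes A: "continuous_map (prod_topology I01 M) T A"
    and \<Phi>: "continuous_map (prod_topology I01 M) M \<Phi>" and \<eta>: "continuous_map M I01 \<eta>"
    and \<Phi>0: "\<And>t. t \<in> topspace M \<Longrightarrow> \<Phi> (0, t) = t"
    and \<Phi>m: "\<And>s. s \<in> {0..1} \<Longrightarrow> \<Phi> (s, m) = m" and "\<eta> m = 0" and m: "m \<in> topspace M"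
  shows "homotopic_with (\<lambda>h. h m = A (0, m)) M T (\<lambda>x. A (0, x)) (\<lambda>x. A (\<eta> x, \<Phi> (1, x)))"
proof -
  have snd: "continuous_map (prod_topology I01 M) M snd" 
    and fst: "continuous_map (prod_topology I01 M) I01 fst"
    by (auto simp: continuous_map_snd continuous_map_fst)
  have c1: "continuous_map (prod_topology I01 M) M (\<lambda>p. \<Phi> (1, snd p))"
    by (intro continuous_map_pair_compose[OF \<Phi>]) (auto simp: snd)
  have "homotopic_with (\<lambda>h. h m = A (0, m)) M T (\<lambda>x. A (0, x)) (\<lambda>x. A (0, \<Phi> (1, x)))"
    by (rule homotopic_withI[where H = "\<lambda>p. A (0, \<Phi> p)"])
      (auto simp: \<Phi>0 \<Phi>m m intro!: continuous_map_pair_compose[OF A] \<Phi>)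
  moreover have "continuous_map (prod_topology I01 M) I01 (\<lambda>p. \<eta> (snd p))"
    using continuous_map_compose[OF snd \<eta>] by (simp add: o_def)
  then have "continuous_map (prod_topology I01 M) I01 (\<lambda>p. fst p * \<eta> (snd p))"
    using fst unfolding continuous_map_I01
    by (auto intro!: continuous_map_real_mult mult_le_one)
  then have "continuous_map (prod_topology I01 M) T (\<lambda>p. A (fst p * \<eta> (snd p), \<Phi> (1, snd p)))"
    by (intro continuous_map_pair_compose[OF A] c1)
  then have "homotopic_with (\<lambda>h. h m = A (0, m)) M T (\<lambda>x. A (0, \<Phi> (1, x))) (\<lambda>x. A (\<eta> x, \<Phi> (1, x)))"
    by (rule homotopic_withI) (auto simp: \<Phi>m m \<open>\<eta> m = 0\<close>)
  ultimately show ?thesis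
    by (rule homotopic_with_trans)
qed

text \<open>By \<open>NDR_slide\<close> both starting maps can be deformed into values taken over
  \<open>m\<close> or at time 1, and there \<open>A\<close> and \<open>B\<close> coincide. This
  plays the role of the uniqueness, up to pointed homotopy, of transport of the base point along a
  path.\<close>

lemma homotopic_rel_point_if_same_trace:
  assumes "NDR_point M m"
    and A: "continuous_map (prod_topology I01 M) T A" and B: "continuous_map (prod_topology I01 M) T B"
    and AB1: "\<And>x. x \<in> topspace M \<Longrightarrow> A (1, x) = B (1, x)"
    and ABm: "\<And>s. s \<in> {0..1} \<Longrightarrow> A (s, m) = B (s, m)"
  shows "homotopic_with (\<lambda>h. h m = A (0, m)) M T (\<lambda>x. A (0, x)) (\<lambda>x. B (0, x))"
proof -
  obtain \<Phi> \<eta> where \<Phi>: "continuous_map (prod_topology I01 M) M \<Phi>" and \<eta>: "continuous_map M I01 \<eta>"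
    and \<Phi>0: "\<And>t. t \<in> topspace M \<Longrightarrow> \<Phi> (0, t) = t"
    and \<Phi>m: "\<And>s. s \<in> {0..1} \<Longrightarrow> \<Phi> (s, m) = m" and \<eta>m: "\<eta> m = 0"
    and \<Phi>1: "\<And>t. t \<in> topspace M \<Longrightarrow> \<Phi> (1, t) = m \<or> \<eta> t = 1"
    and m: "m \<in> topspace M"
    using assms(1) unfolding NDR_point_def by blast
  note slide = NDR_slide[OF _ \<Phi> \<eta> \<Phi>0 \<Phi>m \<eta>m m]
  have "B (\<eta> x, \<Phi> (1, x)) = A (\<eta> x, \<Phi> (1, x))" if x: "x \<in> topspace M" for x
  proof (cases "\<Phi> (1, x) = m")
    case True
    have "\<eta> x \<in> {0..1}"
      using \<eta> x by (auto simp: continuous_map_I01)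
    with True show ?thesis by (simp add: ABm)
  next
    case False
    with \<Phi>1[OF x] have "\<eta> x = 1" by blast
    moreover have "\<Phi> (1, x) \<in> topspace M"
      using \<Phi> x by (auto simp: continuous_map_def)
    ultimately show ?thesis by (simp add: AB1)
  qed
  then have "homotopic_with (\<lambda>h. h m = A (0, m)) M T (\<lambda>x. A (0, x)) (\<lambda>x. B (\<eta> x, \<Phi> (1, x)))"
    by (intro homotopic_with_eq[OF slide[OF A]]) (auto simp: m)
  moreover have "homotopic_with (\<lambda>h. h m = A (0, m)) M T (\<lambda>x. B (0, x)) (\<lambda>x. B (\<eta> x, \<Phi> (1, x)))"
    using slide[OF B] ABm[of 0] by simp
  ultimately show ?thesis
    by (metis (lifting) homotopic_with_symD homotopic_with_trans)
qed

text \<open>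
  \<open>\<kappa>\<close> comes from extending the path from \<open>b'\<close> to \<open>b\<close> traced by the retraction to a homotopy that ends
  in the retraction.
\<close>

lemma NDR_push_back:
  assumes \<Phi>: "continuous_map (prod_topology I01 K) K \<Phi>" and \<eta>: "continuous_map K I01 \<eta>"
    and \<Phi>0: "\<And>t. t \<in> topspace K \<Longrightarrow> \<Phi> (0, t) = t"
    and \<Phi>b: "\<And>s. s \<in> {0..1} \<Longrightarrow> \<Phi> (s, b) = b" and \<eta>b: "\<eta> b = 0"
    and \<Phi>1: "\<And>t. t \<in> topspace K \<Longrightarrow> \<Phi> (1, t) = b \<or> \<eta> t = 1"
    and b: "b \<in> topspace K" and "NDR_point K b'" and b': "\<Phi> (1, b') = b"
  obtains \<kappa> where "continuous_map K K \<kappa>" "\<kappa> b = b'"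
    "homotopic_with (\<lambda>h. h b' = b') K K (\<lambda>x. \<kappa> (\<Phi> (1, x))) (\<lambda>x. x)"
proof -
  have b'K: "b' \<in> topspace K"
    using assms(8) by (simp add: NDR_point_def)
  let ?IK = "prod_topology I01 K"
  have snd: "continuous_map ?IK K snd" and fst: "continuous_map ?IK I01 fst"
    by (auto simp: continuous_map_snd continuous_map_fst)
  have eta: "continuous_map ?IK I01 (\<lambda>p. \<eta> (snd p))"
    using continuous_map_compose[OF snd \<eta>] by (simp add: o_def)
  have \<Phi>s: "continuous_map X K (\<lambda>x. \<Phi> (f x, g x))"
    if "continuous_map X I01 f" "continuous_map X K g" for X :: "'c topology" and f g
    using that by (rule continuous_map_pair_compose[OF \<Phi>])
  \<comment> \<open>Near \<open>b\<close> the value runs along the path from \<open>b'\<close> to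
    \<open>b\<close>, with a head start that grows with \<open>\<eta>\<close>. The factor 2 makes
    the path arrive at \<open>b\<close> on \<open>\<eta> = 1/2\<close>, where
    \<open>\<Phi> (1, _)\<close> is already \<open>b\<close>, so the two cases fit together. The
    \<open>min 1\<close> keeps the time in the interval on all of \<open>?IK\<close>, not only on
    the first piece.\<close>
  define E where "E = (\<lambda>p. if \<eta> (snd p) \<le> 1/2 then \<Phi> (min 1 (max (fst p) (2 * \<eta> (snd p))), b')
                      else \<Phi> (1, snd p))"
  have E: "continuous_map ?IK K E"
    unfolding E_def
  proof (rule continuous_map_cases_le)
    show "continuous_map ?IK euclideanreal (\<lambda>p. \<eta> (snd p))"
      using eta by (simp add: continuous_map_I01)
    have "continuous_map ?IK I01 (\<lambda>p. min 1 (max (fst p) (2 * \<eta> (snd p))))"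
      using eta fst unfolding continuous_map_I01
      by (auto intro!: continuous_intros simp: continuous_map_real_mult_left)
    then show "continuous_map (subtopology ?IK {p \<in> topspace ?IK. \<eta> (snd p) \<le> 1/2}) K
       (\<lambda>p. \<Phi> (min 1 (max (fst p) (2 * \<eta> (snd p))), b'))"
      by (intro continuous_map_from_subtopology \<Phi>s) (auto simp: b'K)
    show "continuous_map (subtopology ?IK {p \<in> topspace ?IK. 1/2 \<le> \<eta> (snd p)}) K (\<lambda>p. \<Phi> (1, snd p))"
      by (intro continuous_map_from_subtopology \<Phi>s snd) auto
    fix p assume p: "p \<in> topspace ?IK" "\<eta> (snd p) = 1/2"
    with \<Phi>1[of "snd p"] have "\<Phi> (1, snd p) = b"
      by auto
    then show "\<Phi> (min 1 (max (fst p) (2 * \<eta> (snd p))), b') = \<Phi> (1, snd p)"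
      using p b' by auto
  qed auto
  have E1: "E (1, x) = \<Phi> (1, x)" if x: "x \<in> topspace K" for x
    using \<Phi>1[OF x] b' by (auto simp: E_def max_def min_def)
  have Eb: "E (s, b) = \<Phi> (s, b')" if "s \<in> {0..1}" for s
    using that by (auto simp: E_def \<eta>b)
  \<comment> \<open>\<open>A\<close> and \<open>B\<close> both end in
    \<open>\<Phi> (1, \<Phi> (1, x))\<close>, and at \<open>b'\<close> both trace the path from
    \<open>b'\<close> to \<open>b\<close> followed by a rest at \<open>b\<close>. They start in
    \<open>E (0, \<Phi> (1, x))\<close> and in \<open>x\<close>, which yields the claim with
    \<open>E (0, _)\<close> as \<open>\<kappa>\<close>. \<open>B\<close> runs \<open>\<Phi>\<close>
    twice because \<open>E\<close> itself ends in the retraction and not in the identity.\<close>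
  define u v :: "real \<times> 'a \<Rightarrow> real" where "u p = min 1 (2 * fst p)" and "v p = max 0 (2 * fst p - 1)" for p
  have u: "continuous_map ?IK I01 u" and v: "continuous_map ?IK I01 v"
    using fst unfolding continuous_map_I01 u_def v_def
    by (auto intro!: continuous_intros simp: continuous_map_real_mult_left)
  define A where "A = (\<lambda>p. E (u p, \<Phi> (1, snd p)))"
  define B where "B = (\<lambda>p. \<Phi> (v p, \<Phi> (u p, snd p)))"
  have A: "continuous_map ?IK K A"
    unfolding A_def by (intro continuous_map_pair_compose[OF E] u \<Phi>s snd) auto
  have B: "continuous_map ?IK K B"
    unfolding B_def by (intro \<Phi>s u v snd)
  have "homotopic_with (\<lambda>h. h b' = A (0, b')) K K (\<lambda>x. A (0, x)) (\<lambda>x. B (0, x))"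
  proof (rule homotopic_rel_point_if_same_trace[OF assms(8) A B])
    fix x assume "x \<in> topspace K"
    then have "\<Phi> (1, x) \<in> topspace K"
      using continuous_map_image_subset_topspace[OF \<Phi>] by auto
    then show "A (1, x) = B (1, x)"
      by (simp add: A_def B_def u_def v_def E1)
  next
    fix s :: real assume "s \<in> {0..1}"
    moreover have "\<Phi> (r, b') \<in> topspace K" if "r \<in> {0..1}" for r
      using continuous_map_image_subset_topspace[OF \<Phi>] b'K that by auto
    ultimately show "A (s, b') = B (s, b')"
      by (cases "s \<le> 1/2") (auto simp: A_def B_def u_def v_def b' Eb \<Phi>b \<Phi>0)
  qed
  moreover have "A (0, x) = E (0, \<Phi> (1, x))" for x
    by (simp add: A_def u_def)
  moreover have "E (0, b) = b'"
    by (simp add: Eb \<Phi>0 b'K)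
  ultimately have h: "homotopic_with (\<lambda>h. h b' = b') K K (\<lambda>x. E (0, \<Phi> (1, x))) (\<lambda>x. B (0, x))"
    by (simp add: b')
  have "homotopic_with (\<lambda>h. h b' = b') K K (\<lambda>x. E (0, \<Phi> (1, x))) (\<lambda>x. x)"
  proof (rule homotopic_with_eq[OF h])
    show "x = B (0, x)" if "x \<in> topspace K" for x
      using that by (simp add: B_def u_def v_def \<Phi>0)
  qed (use b'K in auto)
  moreover have "continuous_map K K (\<lambda>x. E (0, x))"
    by (intro continuous_map_pair_compose[OF E]) auto
  moreover have "E (0, b) = b'"
    by (simp add: Eb \<Phi>0 b'K)
  ultimately show thesis
    using that by blast
qed

text \<open>
  All corrections are made by self-maps of the target, so the point \<open>z\<close> need not be well placed in
  its space.  The times at which the conclusion holds form an open and closed subset of the interval.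
\<close>

proposition homotopy_end_rel_point:
  assumes NDR: "\<And>b. b \<in> topspace K \<Longrightarrow> NDR_point K b"
    and H: "continuous_map (prod_topology I01 Z) K H" and z: "z \<in> topspace Z"
  obtains \<kappa> where "continuous_map K K \<kappa>"
    "homotopic_with (\<lambda>h. h z = H (1, z)) Z K (\<lambda>x. \<kappa> (H (0, x))) (\<lambda>x. H (1, x))"
proof -
  define R where "R t \<longleftrightarrow> (\<exists>\<kappa>. continuous_map K K \<kappa> \<and>
     homotopic_with (\<lambda>h. h z = H (t, z)) Z K (\<lambda>x. \<kappa> (H (0, x))) (\<lambda>x. H (t, x)))" for t
  have Ht: "continuous_map Z K (\<lambda>x. H (t, x))" if "t \<in> {0..1}" for t
    using that by (intro continuous_map_pair_compose[OF H]) auto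
  have Hz: "H (t, z) \<in> topspace K" if "t \<in> {0..1}" for t
    using continuous_map_image_subset_topspace[OF Ht[OF that]] z by auto
  have trace: "continuous_map I01 K (\<lambda>t. H (t, z))"
    using z by (intro continuous_map_pair_compose[OF H]) auto
  have local: "\<exists>T. openin (top_of_set {0..1}) T \<and> \<tau> \<in> T \<and> (\<forall>t\<in>T. R t \<longleftrightarrow> R \<tau>)"
    if \<tau>: "\<tau> \<in> {0..1}" for \<tau>
  proof -
    define b where "b = H (\<tau>, z)"
    have b: "b \<in> topspace K"
      using Hz[OF \<tau>] by (simp add: b_def)
    obtain \<Phi> \<eta> where \<Phi>: "continuous_map (prod_topology I01 K) K \<Phi>" and \<eta>: "continuous_map K I01 \<eta>"
      and \<Phi>0: "\<And>t. t \<in> topspace K \<Longrightarrow> \<Phi> (0, t) = t"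
      and \<Phi>b: "\<And>s. s \<in> {0..1} \<Longrightarrow> \<Phi> (s, b) = b" and \<eta>b: "\<eta> b = 0"
      and \<Phi>1: "\<And>t. t \<in> topspace K \<Longrightarrow> \<Phi> (1, t) = b \<or> \<eta> t = 1"
      using NDR[OF b] unfolding NDR_point_def by blast
    have \<Phi>1c: "continuous_map K K (\<lambda>x. \<Phi> (1, x))"
      by (intro continuous_map_pair_compose[OF \<Phi>]) auto
    define T where "T = {t \<in> topspace I01. \<eta> (H (t, z)) \<in> {..<1}}"
    have "continuous_map I01 euclideanreal (\<lambda>t. \<eta> (H (t, z)))"
      using continuous_map_compose[OF trace \<eta>] by (simp add: o_def continuous_map_I01)
    then have "openin I01 T"
      unfolding T_def by (rule openin_continuous_map_preimage) auto
    moreover have "\<tau> \<in> T"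
      using \<tau> \<eta>b by (simp add: T_def b_def)
    ultimately obtain \<delta> where "\<delta> > 0" and \<delta>: "\<And>t. t \<in> {0..1} \<Longrightarrow> \<bar>t - \<tau>\<bar> < \<delta> \<Longrightarrow> t \<in> T"
      unfolding openin_euclidean_subtopology_iff by (auto simp: dist_real_def)
    have sub: "\<Phi> (1, H (t, z)) = b" if "t \<in> {0..1}" "\<bar>t - \<tau>\<bar> < \<delta>" for t
      using \<delta>[OF that] \<Phi>1[OF Hz[OF that(1)]] by (auto simp: T_def)
    have near: "R t \<longleftrightarrow> R \<tau>" if t: "t \<in> {0..1}" "\<bar>t - \<tau>\<bar> < \<delta>" for t
    proof -
      \<comment> \<open>A pointed passage from time \<open>\<tau>\<close> to time \<open>t\<close>:
        first retract, then let the time run. During the second stage the base point rests at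
        \<open>b\<close>, because \<open>\<Phi> (1, _)\<close> collapses this stretch of the
        trace.\<close>
      have "homotopic_with (\<lambda>h. h z = b) Z K (\<lambda>x. H (\<tau>, x)) (\<lambda>x. \<Phi> (1, H (\<tau>, x)))"
      proof (rule homotopic_withI)
        show "continuous_map (prod_topology I01 Z) K (\<lambda>p. \<Phi> (fst p, H (\<tau>, snd p)))"
          by (intro continuous_map_pair_compose[OF \<Phi>] continuous_map_pair_compose[OF H])
            (use \<tau> in \<open>auto simp: continuous_map_fst continuous_map_snd\<close>)
        show "\<Phi> (fst (0, x), H (\<tau>, snd (0, x))) = H (\<tau>, x)" if "x \<in> topspace Z" for x
          using continuous_map_image_subset_topspace[OF Ht[OF \<tau>]] that by (auto intro: \<Phi>0)
      qed (use z in \<open>auto simp: \<Phi>b b_def[symmetric]\<close>)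
      moreover have "homotopic_with (\<lambda>h. h z = b) Z K (\<lambda>x. \<Phi> (1, H (\<tau>, x))) (\<lambda>x. \<Phi> (1, H (t, x)))"
      proof (rule homotopic_withI)
        have r: "\<tau> + s * (t - \<tau>) \<in> {0..1}" if "s \<in> {0..1}" for s
        proof -
          have "\<tau> + s * (t - \<tau>) = (1 - s) *\<^sub>R \<tau> + s *\<^sub>R t"
            by (simp add: algebra_simps)
          then show ?thesis
            using convex_real_interval(5)[of 0 1] t \<tau> that by (auto simp: convex_alt)
        qed
        have "continuous_map (prod_topology I01 Z) I01 (\<lambda>p. \<tau> + fst p * (t - \<tau>))"
          using r unfolding continuous_map_I01
          by (auto intro!: continuous_intros continuous_map_real_mult_right continuous_map_into_fulltopology[OF continuous_map_fst])
        then show "continuous_map (prod_topology I01 Z) K (\<lambda>p. \<Phi> (1, H (\<tau> + fst p * (t - \<tau>), snd p)))"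
          by (intro continuous_map_pair_compose[OF \<Phi>] continuous_map_pair_compose[OF H])
            (auto simp: continuous_map_snd)
        fix s :: real assume s: "s \<in> {0..1}"
        have "\<bar>\<tau> + s * (t - \<tau>) - \<tau>\<bar> \<le> 1 * \<bar>t - \<tau>\<bar>"
          using s unfolding add_diff_cancel_left' abs_mult by (intro mult_right_mono) auto
        with t(2) show "\<Phi> (1, H (\<tau> + fst (s, z) * (t - \<tau>), snd (s, z))) = b"
          using sub[OF r[OF s]] by simp
      qed (use z in auto)
      ultimately have in_move: "homotopic_with (\<lambda>h. h z = b) Z K (\<lambda>x. H (\<tau>, x)) (\<lambda>x. \<Phi> (1, H (t, x)))"
        by (rule homotopic_with_trans)
      show ?thesis
      proof
        \<comment> \<open>Towards \<open>\<tau>\<close> the retraction itself is the correcting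
          self-map, since it takes \<open>H (t, z)\<close> to \<open>b\<close>.\<close>
        assume "R t"
        then obtain \<kappa> where \<kappa>: "continuous_map K K \<kappa>"
          and "homotopic_with (\<lambda>h. h z = H (t, z)) Z K (\<lambda>x. \<kappa> (H (0, x))) (\<lambda>x. H (t, x))"
          by (auto simp: R_def)
        from homotopic_with_compose_continuous_map_left[OF this(2) \<Phi>1c, where q = "\<lambda>h. h z = b"]
        have "homotopic_with (\<lambda>h. h z = b) Z K (\<lambda>x. \<Phi> (1, \<kappa> (H (0, x)))) (\<lambda>x. \<Phi> (1, H (t, x)))"
          by (simp add: o_def sub[OF t])
        with in_move have "homotopic_with (\<lambda>h. h z = b) Z K (\<lambda>x. \<Phi> (1, \<kappa> (H (0, x)))) (\<lambda>x. H (\<tau>, x))"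
          by (metis (lifting) homotopic_with_symD homotopic_with_trans)
        moreover have "continuous_map K K (\<lambda>x. \<Phi> (1, \<kappa> x))"
          using continuous_map_compose[OF \<kappa> \<Phi>1c] by (simp add: o_def)
        ultimately show "R \<tau>"
          unfolding R_def b_def by (intro exI[of _ "\<lambda>x. \<Phi> (1, \<kappa> x)"]) simp
      next
        \<comment> \<open>Away from \<open>\<tau>\<close> the retraction must be undone:
          \<open>NDR_push_back\<close> supplies a self-map that takes \<open>b\<close> to
          \<open>H (t, z)\<close> and inverts the retraction up to a homotopy fixing
          \<open>H (t, z)\<close>.\<close>
        assume "R \<tau>"
        then obtain \<kappa> where \<kappa>: "continuous_map K K \<kappa>"
          and "homotopic_with (\<lambda>h. h z = b) Z K (\<lambda>x. \<kappa> (H (0, x))) (\<lambda>x. H (\<tau>, x))"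
          by (auto simp: R_def b_def)
        then have h: "homotopic_with (\<lambda>h. h z = b) Z K (\<lambda>x. \<kappa> (H (0, x))) (\<lambda>x. \<Phi> (1, H (t, x)))"
          using in_move homotopic_with_trans by blast
        obtain \<kappa>' where \<kappa>': "continuous_map K K \<kappa>'" "\<kappa>' b = H (t, z)"
          "homotopic_with (\<lambda>h. h (H (t, z)) = H (t, z)) K K (\<lambda>x. \<kappa>' (\<Phi> (1, x))) (\<lambda>x. x)"
          by (rule NDR_push_back[OF \<Phi> \<eta> \<Phi>0 \<Phi>b \<eta>b \<Phi>1 b NDR[OF Hz[OF t(1)]] sub[OF t]])
        have "homotopic_with (\<lambda>h. h z = H (t, z)) Z K (\<lambda>x. \<kappa>' (\<kappa> (H (0, x)))) (\<lambda>x. \<kappa>' (\<Phi> (1, H (t, x))))"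
          using homotopic_with_compose_continuous_map_left[OF h \<kappa>'(1), where q = "\<lambda>h. h z = H (t, z)"]
          by (simp add: o_def \<kappa>'(2))
        moreover have "homotopic_with (\<lambda>h. h z = H (t, z)) Z K (\<lambda>x. \<kappa>' (\<Phi> (1, H (t, x)))) (\<lambda>x. H (t, x))"
          using homotopic_with_compose_continuous_map_right[OF \<kappa>'(3) Ht[OF t(1)], where q = "\<lambda>h. h z = H (t, z)"]
          by (simp add: o_def)
        ultimately have "homotopic_with (\<lambda>h. h z = H (t, z)) Z K (\<lambda>x. \<kappa>' (\<kappa> (H (0, x)))) (\<lambda>x. H (t, x))"
          by (rule homotopic_with_trans)
        moreover have "continuous_map K K (\<lambda>x. \<kappa>' (\<kappa> x))"
          using continuous_map_compose[OF \<kappa> \<kappa>'(1)] by (simp add: o_def)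
        ultimately show "R t"
          unfolding R_def by (intro exI[of _ "\<lambda>x. \<kappa>' (\<kappa> x)"]) simp
      qed
    qed
    show ?thesis
    proof (intro exI conjI ballI)
      show "openin (top_of_set {0..1}) ({0..1} \<inter> ball \<tau> \<delta>)"
        by (auto simp: openin_open)
      show "R t \<longleftrightarrow> R \<tau>" if "t \<in> {0..1} \<inter> ball \<tau> \<delta>" for t
        by (rule near) (use that in \<open>auto simp: dist_real_def abs_minus_commute\<close>)
    qed (use \<tau> \<open>\<delta> > 0\<close> in auto)
  qed
  have "R 0"
    unfolding R_def using Ht[of 0] by (intro exI[of _ "\<lambda>x. x"]) auto
  have "R 1"
  proof (rule connected_induction_simple[where S = "{0..1::real}" and a = 0 and b = 1 and P = R])
    fix \<tau> :: real assume "\<tau> \<in> {0..1}"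
    from local[OF this] show "\<exists>T. openin (top_of_set {0..1}) T \<and> \<tau> \<in> T \<and> (\<forall>x\<in>T. \<forall>y\<in>T. R x \<longrightarrow> R y)"
      by blast
  qed (use \<open>R 0\<close> in auto)
  then show thesis
    using that by (auto simp: R_def)
qed

section \<open>Polyhedra\<close>

lemma topspace_polyhedron: "topspace (polyhedron K) = (\<Union>s\<in>K. closed_simplex s)"
proof
  show "topspace (polyhedron K) \<subseteq> (\<Union>s\<in>K. closed_simplex s)"
    using openin_polyhedron[of K "topspace (polyhedron K)"] by simp
  have "closed_simplex s = (\<Union>s\<in>K. closed_simplex s) \<inter> closed_simplex s" if "s \<in> K" for s
    using that by blast
  then have "openin (polyhedron K) (\<Union>s\<in>K. closed_simplex s)"
    unfolding openin_polyhedron by (metis openin_subtopology_self subset_refl)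
  then show "(\<Union>s\<in>K. closed_simplex s) \<subseteq> topspace (polyhedron K)"
    by (rule openin_subset)
qed

lemma continuous_map_simplex_into_polyhedron:
  assumes "s \<in> K"
  shows "continuous_map (top_of_set (closed_simplex s)) (polyhedron K) (\<lambda>x. x)"
proof -
  have "{x \<in> closed_simplex s. x \<in> U} = U \<inter> closed_simplex s" for U
    by blast
  then show ?thesis
    using assms by (auto simp: continuous_map_def topspace_polyhedron openin_polyhedron)
qed

text \<open>The interval is locally compact, so its product with the weak topology is again weak.\<close>

lemma continuous_map_from_I01_times_polyhedron:
  assumes F: "\<And>s. s \<in> K \<Longrightarrow> continuous_map (prod_topology I01 (top_of_set (closed_simplex s))) T F"
  shows "continuous_map (prod_topology I01 (polyhedron K)) T F"
proof -
  let ?S = "sum_topology (\<lambda>s. top_of_set (closed_simplex s)) K"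
  \<comment> \<open>The weak topology is the quotient of the disjoint sum of the closed simplices,
    and the product with a locally compact Hausdorff space preserves quotient maps.\<close>
  have q: "quotient_map ?S (polyhedron K) snd"
    unfolding quotient_map_def
  proof (intro conjI allI impI)
    show "snd ` topspace ?S = topspace (polyhedron K)"
      by (force simp: topspace_polyhedron)
    fix U assume U: "U \<subseteq> topspace (polyhedron K)"
    have "{x. (s, x) \<in> {p \<in> topspace ?S. snd p \<in> U}} = U \<inter> closed_simplex s" if "s \<in> K" for s
      using that by auto
    then show "openin ?S {p \<in> topspace ?S. snd p \<in> U} = openin (polyhedron K) U"
      using U by (simp add: openin_sum_topology openin_polyhedron topspace_polyhedron)
  qed
  have "locally_compact_space I01"
    by (simp add: compact_imp_locally_compact_space compact_space_subtopology)
  moreover have "Hausdorff_space I01"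
    by (simp add: Hausdorff_space_subtopology)
  ultimately have "quotient_map (prod_topology I01 ?S) (prod_topology I01 (polyhedron K)) (\<lambda>(t, p). (t, snd p))"
    using q quotient_map_prod_right by blast
  moreover have "continuous_map (prod_topology I01 ?S) T (F \<circ> (\<lambda>(t, p). (t, snd p)))"
    unfolding continuous_map_def
  proof (intro conjI allI impI)
    show "F \<circ> (\<lambda>(t, p). (t, snd p)) \<in> topspace (prod_topology I01 ?S) \<rightarrow> topspace T"
      using F continuous_map_image_subset_topspace by fastforce
    fix U assume U: "openin T U"
    show "openin (prod_topology I01 ?S)
      {x \<in> topspace (prod_topology I01 ?S). (F \<circ> (\<lambda>(t, p). (t, snd p))) x \<in> U}"
      unfolding openin_prod_topology_alt
    proof (intro allI impI)
      fix t p assume tp: "(t, p) \<in> {x \<in> topspace (prod_topology I01 ?S). (F \<circ> (\<lambda>(t, p). (t, snd p))) x \<in> U}"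
      obtain s x where p: "p = (s, x)"
        by (cases p)
      have s: "s \<in> K" "x \<in> closed_simplex s" "t \<in> {0..1}" "F (t, x) \<in> U"
        using tp p by auto
      have "openin (prod_topology I01 (top_of_set (closed_simplex s)))
         {y \<in> topspace (prod_topology I01 (top_of_set (closed_simplex s))). F y \<in> U}"
        using F[OF s(1)] U openin_continuous_map_preimage by blast
      then have "\<exists>V W. openin I01 V \<and> openin (top_of_set (closed_simplex s)) W \<and> t \<in> V \<and> x \<in> W \<and>
        V \<times> W \<subseteq> {y \<in> topspace (prod_topology I01 (top_of_set (closed_simplex s))). F y \<in> U}"
        unfolding openin_prod_topology_alt using s by (auto simp del: prod_topology_subtopology_eu)
      then obtain V W where VW: "openin I01 V" "openin (top_of_set (closed_simplex s)) W" "t \<in> V" "x \<in> W"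
        "V \<times> W \<subseteq> {y \<in> topspace (prod_topology I01 (top_of_set (closed_simplex s))). F y \<in> U}"
        by auto
      have "openin ?S ({s} \<times> W)"
        unfolding openin_sum_topology
      proof (intro conjI ballI)
        show "{s} \<times> W \<subseteq> Sigma K (topspace \<circ> (\<lambda>s. top_of_set (closed_simplex s)))"
          using openin_subset[OF VW(2)] s(1) by auto
        show "openin (top_of_set (closed_simplex i)) {x. (i, x) \<in> {s} \<times> W}" for i
          using VW(2) by (cases "i = s") auto
      qed
      then show "\<exists>V W. openin I01 V \<and> openin ?S W \<and> t \<in> V \<and> p \<in> W \<and>
         V \<times> W \<subseteq> {x \<in> topspace (prod_topology I01 ?S). (F \<circ> (\<lambda>(t, p). (t, snd p))) x \<in> U}"
        using VW s(1) p by (intro exI[of _ V] exI[of _ "{s} \<times> W"]) auto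
    qed
  qed
  ultimately show ?thesis
    by (rule continuous_compose_quotient_map)
qed

lemma finite_support_polyhedron:
  assumes "abstract_complex K" "x \<in> topspace (polyhedron K)"
  shows "finite {v. x v \<noteq> 0}"
proof -
  obtain s where "s \<in> K" "x \<in> closed_simplex s"
    using assms(2) by (auto simp: topspace_polyhedron)
  moreover from this have "{v. x v \<noteq> 0} \<subseteq> s" "finite s"
    using assms(1) by (auto simp: closed_simplex_def abstract_complex_def)
  ultimately show ?thesis
    by (metis finite_subset)
qed

lemma closed_simplex_of_support:
  assumes "finite s" "finite s'" "b \<in> closed_simplex s'" "{v. b v \<noteq> 0} \<subseteq> s"
  shows "b \<in> closed_simplex s"
proof -
  have "sum b s = sum b {v. b v \<noteq> 0}"
    using assms by (intro sum.mono_neutral_right) auto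
  also have "\<dots> = sum b s'"
    using assms by (intro sum.mono_neutral_left) (auto simp: closed_simplex_def)
  finally show ?thesis
    using assms by (auto simp: closed_simplex_def)
qed

lemma closed_simplex_convex:
  assumes "x \<in> closed_simplex s" "y \<in> closed_simplex s" "0 \<le> r" "r \<le> 1"
  shows "(\<lambda>v. (1 - r) * x v + r * y v) \<in> closed_simplex s"
  using assms by (auto simp: closed_simplex_def sum.distrib sum_distrib_left[symmetric])

text \<open>
  Points whose coordinates on the support of \<open>b\<close> are positive are pushed towards \<open>b\<close> along straight
  lines; \<open>m x\<close> measures how close \<open>x\<close> is to \<open>b\<close>.
\<close>

lemma NDR_point_polyhedron:
  assumes K: "abstract_complex K" and b: "b \<in> topspace (polyhedron K)"
  shows "NDR_point (polyhedron K) b"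
proof -
  define B where "B = {v. b v \<noteq> 0}"
  have B: "finite B"
    using finite_support_polyhedron[OF K b] by (simp add: B_def)
  obtain s' where s': "s' \<in> K" "b \<in> closed_simplex s'"
    using b by (auto simp: topspace_polyhedron)
  have bpos: "b v > 0" if "v \<in> B" for v
    using s'(2) that by (auto simp: closed_simplex_def B_def less_le)
  \<comment> \<open>On the polyhedron the product vanishes iff some coordinate on the support of
    \<open>b\<close> does. It is 1 only at \<open>b\<close>: the coordinates sum to 1, so
    \<open>x v \<ge> b v\<close> on \<open>B\<close> forces \<open>x = b\<close>.\<close>
  define m where "m x = (\<Prod>v\<in>B. min 1 (x v / b v))" for x
  \<comment> \<open>At time 1 the weight of \<open>b\<close> is 1 as soon as
    \<open>m x \<ge> 1/2\<close>, while \<open>\<eta> x = 1\<close> as soon as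
    \<open>m x \<le> 1/2\<close>; the common threshold gives the required alternative for every
    point.\<close>
  define \<Phi> where "\<Phi> = (\<lambda>(t, x). \<lambda>v. (1 - t * min 1 (2 * m x)) * x v + t * min 1 (2 * m x) * b v)"
  define \<eta> where "\<eta> x = min 1 (2 - 2 * m x)" for x
  have m01: "0 \<le> m x" "m x \<le> 1" if "x \<in> closed_simplex s" for x s
    using that bpos unfolding m_def
    by (auto simp: closed_simplex_def less_imp_le intro!: prod_nonneg prod_le_1)
  have mb: "m b = 1"
    using bpos by (force simp: m_def intro: prod.neutral)
  have contm: "continuous_on S m" for S
    unfolding m_def
    by (intro continuous_on_prod continuous_intros continuous_on_product_coordinates)
      (use continuous_on_subset[OF continuous_on_product_coordinates subset_UNIV] in \<open>auto simp: B_def\<close>)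
  \<comment> \<open>If \<open>m x = 0\<close>, the point does not move. Otherwise the support of
    \<open>b\<close> lies in \<open>s\<close>, so \<open>b\<close> belongs to the closed simplex and
    the segment from \<open>x\<close> to \<open>b\<close> stays in it.\<close>
  have \<Phi>S: "\<Phi> (t, x) \<in> closed_simplex s" if "s \<in> K" "x \<in> closed_simplex s" "t \<in> {0..1}" for s x t
  proof (cases "m x = 0")
    case True
    then show ?thesis using that by (simp add: \<Phi>_def)
  next
    case False
    have "x v \<noteq> 0" if "v \<in> B" for v
    proof
      assume "x v = 0"
      then have "min 1 (x v / b v) = 0"
        by simp
      with that B have "m x = 0"
        unfolding m_def by (metis (no_types, lifting) prod_zero)
      with False show False ..
    qed
    then have "{v. b v \<noteq> 0} \<subseteq> s"
      using that(2) by (auto simp: closed_simplex_def B_def)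
    then have "b \<in> closed_simplex s"
      using closed_simplex_of_support K s' that(1) unfolding abstract_complex_def by metis
    moreover have "0 \<le> t * min 1 (2 * m x)" "t * min 1 (2 * m x) \<le> 1"
      using that m01[OF that(2)] by (auto intro: mult_le_one)
    ultimately show ?thesis
      unfolding \<Phi>_def using closed_simplex_convex[OF that(2)] by simp
  qed
  have "continuous_map (prod_topology I01 (polyhedron K)) (polyhedron K) \<Phi>"
  proof (rule continuous_map_from_I01_times_polyhedron)
    fix s assume s: "s \<in> K"
    have m: "continuous_on ({0..1::real} \<times> closed_simplex s) (\<lambda>p. m (snd p))"
      by (rule continuous_on_compose2[OF contm[of UNIV]]) (auto intro: continuous_intros)
    have v: "continuous_on ({0..1::real} \<times> closed_simplex s) (\<lambda>p. snd p v)" for v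
      by (rule continuous_on_compose2[OF continuous_on_product_coordinates]) (auto intro: continuous_intros)
    have "continuous_on ({0..1} \<times> closed_simplex s) \<Phi>"
      unfolding \<Phi>_def case_prod_unfold
      by (rule continuous_on_coordinatewise_then_product) (intro continuous_intros m v)
    then have "continuous_map (prod_topology I01 (top_of_set (closed_simplex s))) (top_of_set (closed_simplex s)) \<Phi>"
      using \<Phi>S[OF s] by (auto simp: prod_topology_subtopology_eu)
    from continuous_map_compose[OF this continuous_map_simplex_into_polyhedron[OF s]]
    show "continuous_map (prod_topology I01 (top_of_set (closed_simplex s))) (polyhedron K) \<Phi>"
      by (simp add: o_def)
  qed
  moreover have "continuous_map (polyhedron K) I01 \<eta>"
  proof -
    \<comment> \<open>Continuity on the polyhedron alone is obtained from the result on products, by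
      freezing the time at 0 afterwards.\<close>
    have "continuous_map (prod_topology I01 (polyhedron K)) euclideanreal (\<lambda>p. \<eta> (snd p))"
    proof (rule continuous_map_from_I01_times_polyhedron)
      fix s assume s: "s \<in> K"
      have "continuous_on ({0..1::real} \<times> closed_simplex s) (\<lambda>p. \<eta> (snd p))"
        unfolding \<eta>_def
        by (intro continuous_intros continuous_on_compose2[OF contm[of UNIV]]) (rule subset_UNIV)
      then show "continuous_map (prod_topology I01 (top_of_set (closed_simplex s))) euclideanreal (\<lambda>p. \<eta> (snd p))"
        by (simp add: prod_topology_subtopology_eu)
    qed
    from continuous_map_pair_compose[OF this, of "polyhedron K" "\<lambda>_. 0" "\<lambda>x. x"]
    have "continuous_map (polyhedron K) euclideanreal \<eta>"
      by simp
    then show ?thesis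
      using m01 by (auto simp: continuous_map_I01 topspace_polyhedron \<eta>_def)
  qed
  moreover have "\<Phi> (1, x) = b \<or> \<eta> x = 1" for x
    by (cases "m x \<ge> 1/2") (auto simp: \<Phi>_def \<eta>_def)
  ultimately show ?thesis
    unfolding NDR_point_def using b
    by (intro conjI exI[of _ \<Phi>] exI[of _ \<eta>]) (auto simp: \<Phi>_def \<eta>_def mb algebra_simps)
qed

section \<open>Cardinality of polyhedra compared with the universe\<close>

lemma lists_lepoll_infinite:
  assumes "infinite (UNIV :: 'a set)"
  shows "(UNIV :: 'a list set) \<lesssim> (UNIV :: 'a set)"
proof -
  obtain p :: "'a \<times> 'a \<Rightarrow> 'a" where p: "inj p"
    using card_of_Times_same_infinite[OF assms] unfolding card_of_ordIso[symmetric]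
    by (auto simp: bij_betw_def)
  obtain c d :: 'a where cd: "c \<noteq> d"
    using assms by (metis (full_types) UNIV_eq_I finite.simps insertI1)
  \<comment> \<open>A list is coded by iterated pairing; the first entry of the outer pair is
    \<open>d\<close> at the end of the list and \<open>c\<close> at every other cell, which makes
    the code injective.\<close>
  define g where "g = (\<lambda>xs. foldr (\<lambda>x r. p (c, p (x, r))) xs (p (d, d)))"
  have "g xs = g ys \<Longrightarrow> xs = ys" for xs ys
  proof (induction xs arbitrary: ys)
    case Nil
    then show ?case
      using cd by (cases ys) (auto simp: g_def inj_eq[OF p])
  next
    case (Cons x xs)
    then show ?case
      using cd by (cases ys) (auto simp: g_def inj_eq[OF p])
  qed
  then have "inj g"
    by (rule injI)
  then show ?thesis
    unfolding lepoll_def by (intro exI[of _ g]) simp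
qed

text \<open>A point is determined by the finite graph of its nonzero coordinates, and an infinite
  universe of at least continuum size absorbs pairs with reals, finite sets and lists.\<close>

lemma polyhedron_lepoll_universe:
  assumes u: "(UNIV :: real set) \<lesssim> (UNIV :: 'u set)" and K: "abstract_complex (K :: 'u set set)"
  shows "topspace (polyhedron K) \<lesssim> (UNIV :: 'u set)"
proof -
  have inf: "infinite (UNIV :: 'u set)"
    using lepoll_trans[OF infinite_le_lepoll[THEN iffD1, OF infinite_UNIV_char_0] u]
    by (rule infinite_le_lepoll[THEN iffD2])
  have "topspace (polyhedron K) \<subseteq> {x. x ` UNIV \<subseteq> UNIV \<and> {v. x v \<noteq> 0} \<subseteq> UNIV \<and> finite {v. x v \<noteq> 0}}"
    using finite_support_polyhedron[OF K] by auto
  then have "topspace (polyhedron K) \<lesssim> Fpow (UNIV \<times> UNIV :: ('u \<times> real) set)"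
    by (rule lepoll_trans[OF subset_imp_lepoll lepoll_restricted_funspace])
  also have "\<dots> \<lesssim> (UNIV :: ('u \<times> real) list set)"
  proof -
    have "inv_into UNIV set ` Fpow UNIV \<subseteq> (UNIV :: ('u \<times> real) list set)"
      by simp
    moreover have "inj_on (inv_into UNIV set) (Fpow (UNIV :: ('u \<times> real) set))"
      by (rule inj_on_inv_into) (auto simp: Fpow_def finite_list image_iff dest: finite_list)
    ultimately show ?thesis
      unfolding lepoll_def by auto
  qed
  also have "\<dots> \<lesssim> (UNIV :: 'u list set)"
  proof -
    have "(UNIV :: ('u \<times> real) set) \<lesssim> (UNIV :: ('u \<times> 'u) set)"
      using times_lepoll_mono[OF lepoll_refl u] by (simp flip: UNIV_Times_UNIV)
    also have "\<dots> \<lesssim> (UNIV :: 'u set)"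
      using card_of_Times_same_infinite[OF inf] unfolding card_of_ordIso[symmetric]
      by (auto simp: bij_betw_def lepoll_def)
    finally show ?thesis
      using lists_lepoll_mono by force
  qed
  also have "\<dots> \<lesssim> (UNIV :: 'u set)"
    by (rule lists_lepoll_infinite[OF inf])
  finally show ?thesis .
qed

section \<open>Factorization through expansions\<close>

lemma based_map_compose:
  assumes "based_map X xs Y ys f" "based_map Y ys Z zs g"
  shows "based_map X xs Z zs (g \<circ> f)"
  using assms by (auto simp: based_map_def intro: continuous_map_compose)

lemma based_homotopic_refl: "based_map X xs Y ys f \<Longrightarrow> based_homotopic X xs Y ys f f"
  by (simp add: based_map_def based_homotopic_def)

lemma based_homotopic_sym: "based_homotopic X xs Y ys f g \<Longrightarrow> based_homotopic X xs Y ys g f"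
  unfolding based_homotopic_def by (rule homotopic_with_symD)

lemma based_homotopic_trans [trans]:
  "based_homotopic X xs Y ys f g \<Longrightarrow> based_homotopic X xs Y ys g h \<Longrightarrow> based_homotopic X xs Y ys f h"
  unfolding based_homotopic_def by (rule homotopic_with_trans)

lemma based_homotopic_imp_based_map:
  assumes "based_homotopic X xs Y ys f g"
  shows "based_map X xs Y ys f" "based_map X xs Y ys g"
  using homotopic_with_imp_continuous_maps homotopic_with_imp_property assms
  unfolding based_homotopic_def based_map_def by blast+

lemma based_homotopic_compose_left:
  assumes "based_homotopic X xs Y ys f g" "based_map Y ys Z zs h"
  shows "based_homotopic X xs Z zs (h \<circ> f) (h \<circ> g)"
  using assms unfolding based_homotopic_def based_map_def
  by (auto intro: homotopic_with_compose_continuous_map_left)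

lemma based_homotopic_compose_right:
  assumes "based_homotopic Y ys Z zs f g" "based_map X xs Y ys h"
  shows "based_homotopic X xs Z zs (f \<circ> h) (g \<circ> h)"
  using assms unfolding based_homotopic_def based_map_def
  by (auto intro: homotopic_with_compose_continuous_map_right)

lemma based_homotopic_equal:
  assumes "based_map X xs Y ys f" "\<And>x. x \<in> topspace X \<Longrightarrow> f x = g x" "set xs \<subseteq> topspace X"
  shows "based_homotopic X xs Y ys f g"
proof -
  have "map g xs = map f xs"
    using assms(2,3) by (metis (no_types, lifting) map_eq_conv subsetD)
  then show ?thesis
    using assms unfolding based_homotopic_def based_map_def by (intro homotopic_with_equal) auto
qed

lemma HPol_polyhedron:
  assumes "abstract_complex (K :: 'u set set)" "set bs \<subseteq> topspace (polyhedron K)"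
  shows "HPol TYPE('u) (polyhedron K) bs"
proof -
  have "based_map (polyhedron K) bs (polyhedron K) bs id"
    by (simp add: based_map_def)
  then have "based_homotopy_equivalent (polyhedron K) bs (polyhedron K) bs"
    unfolding based_homotopy_equivalent_def using based_homotopic_refl by fastforce
  then show ?thesis
    using assms unfolding HPol_def by blast
qed

text \<open>(E1) and (E2) quantify over test spaces with points in \<open>'u\<close>, whereas
  \<open>P\<close> has an arbitrary type. The polyhedron of \<open>P\<close> has few enough points
  to be copied into \<open>'u\<close> along an injection \<open>e\<close>; the topology pulled back
  along the inverse makes \<open>e\<close> a homeomorphism. Domination of \<open>P\<close> by the
  copy is what the later transfer uses.\<close>

lemma HPol_dominated_in_universe:
  fixes P :: "'r topology"
  assumes universe: "(UNIV :: real set) \<lesssim> (UNIV :: 'u set)" and P: "HPol TYPE('u) P ps"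
  obtains Q :: "'u topology" and qs u u' where "HPol TYPE('u) Q qs" "based_map P ps Q qs u"
    "based_map Q qs P ps u'" "based_homotopic P ps P ps (u' \<circ> u) id"
proof -
  obtain K :: "'u set set" and bs r r' where K: "abstract_complex K" "set bs \<subseteq> topspace (polyhedron K)"
    and len: "length bs = length ps"
    and r: "based_map P ps (polyhedron K) bs r" "based_map (polyhedron K) bs P ps r'"
      "based_homotopic P ps P ps (r' \<circ> r) id"
    using P unfolding HPol_def based_homotopy_equivalent_def by blast
  let ?T = "topspace (polyhedron K)"
  obtain e :: "('u \<Rightarrow> real) \<Rightarrow> 'u" where e: "inj_on e ?T"
    using polyhedron_lepoll_universe[OF universe K(1)] by (auto simp: lepoll_def)
  define g where "g = inv_into ?T e"
  have ge: "g (e t) = t" if "t \<in> ?T" for t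
    using that e by (simp add: g_def)
  define Q where "Q = pullback_topology (e ` ?T) g (polyhedron K)"
  have TQ: "topspace Q = e ` ?T"
    by (auto simp: Q_def topspace_pullback_topology ge)
  have ebs: "set (map e bs) \<subseteq> topspace Q"
    using K(2) by (auto simp: TQ)
  have "continuous_map (polyhedron K) Q e"
    unfolding Q_def
  proof (rule continuous_map_pullback')
    show "continuous_map (polyhedron K) (polyhedron K) (g \<circ> e)"
      using continuous_map_eq[OF continuous_map_id, of "polyhedron K" "g \<circ> e"] ge by simp
  qed auto
  then have e': "based_map (polyhedron K) bs Q (map e bs) e"
    by (simp add: based_map_def)
  have "continuous_map Q (polyhedron K) g"
    using continuous_map_pullback[OF continuous_map_id, of "e ` ?T" g "polyhedron K"] by (simp add: Q_def)
  moreover have "map g (map e bs) = bs"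
    using K(2) by (simp add: map_idI subset_iff ge)
  ultimately have g: "based_map Q (map e bs) (polyhedron K) bs g"
    by (simp add: based_map_def)
  have geid: "based_homotopic (polyhedron K) bs (polyhedron K) bs (g \<circ> e) id"
    by (rule based_homotopic_equal[OF based_map_compose[OF e' g]]) (use K ge in auto)
  have "based_homotopic Q (map e bs) Q (map e bs) (e \<circ> g) id"
    by (rule based_homotopic_equal[OF based_map_compose[OF g e'] _ ebs]) (auto simp: TQ ge)
  then have "based_homotopy_equivalent Q (map e bs) (polyhedron K) bs"
    using g e' geid unfolding based_homotopy_equivalent_def by blast
  then have "HPol TYPE('u) Q (map e bs)"
    unfolding HPol_def using K by force
  moreover have "based_homotopic P ps P ps ((r' \<circ> g) \<circ> (e \<circ> r)) id"
  proof -
    have "based_homotopic P ps P ps (r' \<circ> ((g \<circ> e) \<circ> r)) (r' \<circ> (id \<circ> r))"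
      by (intro based_homotopic_compose_left[OF _ r(2)] based_homotopic_compose_right[OF geid r(1)])
    with r(3) show ?thesis
      by (simp add: o_assoc based_homotopic_trans)
  qed
  ultimately show thesis
    using that based_map_compose[OF r(1) e'] based_map_compose[OF g r(2)] by blast
qed

section \<open>(E1) and (E2) for targets of arbitrary type\<close>

lemma HPol_expansion_maps:
  assumes "HPol_expansion U X xs S p"
  shows "i \<in> index S \<Longrightarrow> based_map X xs (obj S i) (pts S i) (p i)"
    and "i \<in> index S \<Longrightarrow> HPol U (obj S i) (pts S i)"
    and "i \<in> index S \<Longrightarrow> j \<in> index S \<Longrightarrow> leq S i j \<Longrightarrow>
      based_map (obj S j) (pts S j) (obj S i) (pts S i) (bond S i j)"
    and "i \<in> index S \<Longrightarrow> j \<in> index S \<Longrightarrow> leq S i j \<Longrightarrow>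
      based_homotopic X xs (obj S i) (pts S i) (bond S i j \<circ> p j) (p i)"
    and "directed_set (index S) (leq S)"
  using assms by (auto simp: HPol_expansion_def pro_map_def inverse_system_def)

text \<open>(E1) factors \<open>u \<circ> h\<close> through a term of the system, and
  \<open>u'\<close> brings the factor back to \<open>P\<close>; a one-sided homotopy inverse is
  enough for this.\<close>

lemma HPol_expansion_factor:
  fixes P :: "'r topology"
  assumes universe: "(UNIV :: real set) \<lesssim> (UNIV :: 'u set)"
    and S: "HPol_expansion TYPE('u) X xs S p"
    and P: "HPol TYPE('u) P ps" and h: "based_map X xs P ps h"
  obtains i f where "i \<in> index S" "based_map (obj S i) (pts S i) P ps f"
    "based_homotopic X xs P ps (f \<circ> p i) h"
proof -
  obtain Q :: "'u topology" and qs u u' where Q: "HPol TYPE('u) Q qs" and u: "based_map P ps Q qs u"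
    "based_map Q qs P ps u'" "based_homotopic P ps P ps (u' \<circ> u) id"
    using HPol_dominated_in_universe[OF universe P] .
  from based_map_compose[OF h u(1)] Q S obtain i f where i: "i \<in> index S"
    and f: "based_map (obj S i) (pts S i) Q qs f" "based_homotopic X xs Q qs (f \<circ> p i) (u \<circ> h)"
    unfolding HPol_expansion_def by blast
  have "based_homotopic X xs P ps ((u' \<circ> f) \<circ> p i) ((u' \<circ> u) \<circ> h)"
    using based_homotopic_compose_left[OF f(2) u(2)] by (simp add: o_assoc)
  also have "based_homotopic X xs P ps ((u' \<circ> u) \<circ> h) h"
    using based_homotopic_compose_right[OF u(3) h] by simp
  finally show thesis
    using that[OF i based_map_compose[OF f(1) u(2)]] by blast
qed

lemma HPol_expansion_factor_unique:
  fixes P :: "'r topology"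
  assumes universe: "(UNIV :: real set) \<lesssim> (UNIV :: 'u set)"
    and S: "HPol_expansion TYPE('u) X xs S p"
    and P: "HPol TYPE('u) P ps" and i: "i \<in> index S"
    and f: "based_map (obj S i) (pts S i) P ps f" "based_map (obj S i) (pts S i) P ps f'"
      "based_homotopic X xs P ps (f \<circ> p i) (f' \<circ> p i)"
  obtains j where "j \<in> index S" "leq S i j"
    "based_homotopic (obj S j) (pts S j) P ps (f \<circ> bond S i j) (f' \<circ> bond S i j)"
proof -
  obtain Q :: "'u topology" and qs u u' where Q: "HPol TYPE('u) Q qs" and u: "based_map P ps Q qs u"
    "based_map Q qs P ps u'" "based_homotopic P ps P ps (u' \<circ> u) id"
    using HPol_dominated_in_universe[OF universe P] .
  have "based_homotopic X xs Q qs ((u \<circ> f) \<circ> p i) ((u \<circ> f') \<circ> p i)"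
    using based_homotopic_compose_left[OF f(3) u(1)] by (simp add: o_assoc)
  then obtain j where j: "j \<in> index S" "leq S i j" and
    h: "based_homotopic (obj S j) (pts S j) Q qs ((u \<circ> f) \<circ> bond S i j) ((u \<circ> f') \<circ> bond S i j)"
    using S i Q based_map_compose[OF f(1) u(1)] based_map_compose[OF f(2) u(1)]
    unfolding HPol_expansion_def by blast
  have retract: "based_homotopic (obj S j) (pts S j) P ps ((u' \<circ> u) \<circ> (k \<circ> bond S i j)) (k \<circ> bond S i j)"
    if "based_map (obj S i) (pts S i) P ps k" for k
    using based_homotopic_compose_right[OF u(3) based_map_compose[OF HPol_expansion_maps(3)[OF S i j] that]]
    by simp
  have "based_homotopic (obj S j) (pts S j) P ps ((u' \<circ> u) \<circ> (f \<circ> bond S i j)) ((u' \<circ> u) \<circ> (f' \<circ> bond S i j))"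
    using based_homotopic_compose_left[OF h u(2)] by (simp add: o_assoc)
  then have "based_homotopic (obj S j) (pts S j) P ps (f \<circ> bond S i j) (f' \<circ> bond S i j)"
    using retract[OF f(1)] retract[OF f(2)] based_homotopic_sym based_homotopic_trans by meson
  with j show thesis
    using that by blast
qed

text \<open>A free map becomes pointed once the image of \<open>x\<close> is declared the base point
  of the target. This is done in the polyhedron, where every point is admissible; \<open>P\<close>
  has only the free homotopy type of it, and \<open>P\<close> with the point \<open>h x\<close>
  might fail to be an object of the pointed category.\<close>

lemma pointed_HPol_expansion_free_factor:
  fixes P :: "'r topology"
  assumes universe: "(UNIV :: real set) \<lesssim> (UNIV :: 'u set)"
    and S: "HPol_expansion TYPE('u) X [x] S p" and x: "x \<in> topspace X"
    and P: "HPol TYPE('u) P []" and h: "continuous_map X P h"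
  obtains i f where "i \<in> index S" "continuous_map (obj S i) P f"
    "homotopic_with (\<lambda>_. True) X P (f \<circ> p i) h"
proof -
  obtain K :: "'u set set" and r r' where K: "abstract_complex K"
    and r: "continuous_map P (polyhedron K) r" "continuous_map (polyhedron K) P r'"
      "homotopic_with (\<lambda>_. True) P P (r' \<circ> r) id"
    using P by (auto simp: HPol_def based_homotopy_equivalent_def based_map_def based_homotopic_def)
  have rh: "continuous_map X (polyhedron K) (r \<circ> h)"
    using h r(1) by (rule continuous_map_compose)
  then have "(r \<circ> h) x \<in> topspace (polyhedron K)"
    using x continuous_map_image_subset_topspace by blast
  then have "HPol TYPE('u) (polyhedron K) [(r \<circ> h) x]"
    using K by (intro HPol_polyhedron) auto
  moreover have "based_map X [x] (polyhedron K) [(r \<circ> h) x] (r \<circ> h)"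
    using rh by (simp add: based_map_def)
  ultimately obtain i f where i: "i \<in> index S"
    and f: "based_map (obj S i) (pts S i) (polyhedron K) [(r \<circ> h) x] f"
      "based_homotopic X [x] (polyhedron K) [(r \<circ> h) x] (f \<circ> p i) (r \<circ> h)"
    using HPol_expansion_factor[OF universe S] by blast
  have "homotopic_with (\<lambda>_. True) X (polyhedron K) (f \<circ> p i) (r \<circ> h)"
    using f(2) unfolding based_homotopic_def by (rule homotopic_with_mono) auto
  from homotopic_with_compose_continuous_map_left[OF this r(2)]
  have "homotopic_with (\<lambda>_. True) X P ((r' \<circ> f) \<circ> p i) ((r' \<circ> r) \<circ> h)"
    by (simp add: o_assoc)
  moreover have "homotopic_with (\<lambda>_. True) X P ((r' \<circ> r) \<circ> h) h"
    using homotopic_with_compose_continuous_map_right[OF r(3) h] by simp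
  ultimately have "homotopic_with (\<lambda>_. True) X P ((r' \<circ> f) \<circ> p i) h"
    by (rule homotopic_with_trans)
  moreover have "continuous_map (obj S i) P (r' \<circ> f)"
    using f(1) r(2) by (auto simp: based_map_def intro: continuous_map_compose)
  ultimately show thesis
    using that i by blast
qed

text \<open>
  The unpointed expansion of the product only gives a free homotopy; its end is made pointed by
  composing with a self-map of the polyhedron.
\<close>

proposition pointed_product_factor:
  fixes P :: "'r topology"
  assumes universe: "(UNIV :: real set) \<lesssim> (UNIV :: 'u set)"
    and XX: "HPol_expansion TYPE('u) X [] XX p" and YY: "HPol_expansion TYPE('u) Y [] YY q"
    and XY: "HPol_expansion TYPE('u) (prod_topology X Y) [] (prod_sys XX YY) (prod_pro_map p q)"
    and x: "x \<in> topspace X" and y: "y \<in> topspace Y"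
    and A: "HPol_expansion TYPE('u) X [x] A a" and B: "HPol_expansion TYPE('u) Y [y] B b"
    and P: "HPol TYPE('u) P ps" and h: "based_map (prod_topology X Y) [(x, y)] P ps h"
  obtains l m f where "l \<in> index A" "m \<in> index B"
    "based_map (prod_topology (obj A l) (obj B m)) (zip (pts A l) (pts B m)) P ps f"
    "based_homotopic (prod_topology X Y) [(x, y)] P ps (f \<circ> map_prod (a l) (b m)) h"
proof -
  let ?XY = "prod_topology X Y"
  have ps: "ps = [h (x, y)]" and ch: "continuous_map ?XY P h"
    using h by (auto simp: based_map_def)
  obtain K :: "'u set set" and bs r r' where K: "abstract_complex K" "set bs \<subseteq> topspace (polyhedron K)"
    and r: "based_map P ps (polyhedron K) bs r" "based_map (polyhedron K) bs P ps r'"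
      "based_homotopic P ps P ps (r' \<circ> r) id"
    using P unfolding HPol_def based_homotopy_equivalent_def by blast
  have cr: "continuous_map P (polyhedron K) r" "bs = [r (h (x, y))]"
    using r(1) by (auto simp: based_map_def ps)
  have "HPol TYPE('u) (polyhedron K) []"
    using HPol_polyhedron[OF K(1)] by simp
  moreover have "based_map ?XY [] (polyhedron K) [] (r \<circ> h)"
    using ch cr(1) by (auto simp: based_map_def intro: continuous_map_compose)
  ultimately obtain ij f where ij: "ij \<in> index (prod_sys XX YY)"
    and f: "based_map (obj (prod_sys XX YY) ij) (pts (prod_sys XX YY) ij) (polyhedron K) [] f"
    and hf: "based_homotopic ?XY [] (polyhedron K) [] (f \<circ> prod_pro_map p q ij) (r \<circ> h)"
    using HPol_expansion_factor[OF universe XY] by blast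
  obtain i j where "ij = (i, j)" and i: "i \<in> index XX" and j: "j \<in> index YY"
    using ij by (auto simp: prod_sys_def)
  have f: "continuous_map (prod_topology (obj XX i) (obj YY j)) (polyhedron K) f"
    using f by (simp add: \<open>ij = (i, j)\<close> based_map_def prod_sys_def)
  have hf: "homotopic_with (\<lambda>_. True) ?XY (polyhedron K) (f \<circ> map_prod (p i) (q j)) (r \<circ> h)"
    using hf by (simp add: \<open>ij = (i, j)\<close> based_homotopic_def prod_pro_map_def)
  have pts: "pts XX i = []" "pts YY j = []"
    using HPol_expansion_maps(1)[OF XX i] HPol_expansion_maps(1)[OF YY j] by (auto simp: based_map_def)
  \<comment> \<open>The free maps \<open>p i\<close> and \<open>q j\<close> factor, up to free
    homotopy, through terms of the pointed expansions; thus the factorization through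
    \<open>XX\<close> and \<open>YY\<close> is replaced by one through \<open>A\<close> and
    \<open>B\<close>.\<close>
  obtain l u where l: "l \<in> index A" and u: "continuous_map (obj A l) (obj XX i) u"
    "homotopic_with (\<lambda>_. True) X (obj XX i) (u \<circ> a l) (p i)"
    using pointed_HPol_expansion_free_factor[OF universe A x] HPol_expansion_maps(1,2)[OF XX i]
    unfolding pts based_map_def by metis
  obtain m v where m: "m \<in> index B" and v: "continuous_map (obj B m) (obj YY j) v"
    "homotopic_with (\<lambda>_. True) Y (obj YY j) (v \<circ> b m) (q j)"
    using pointed_HPol_expansion_free_factor[OF universe B y] HPol_expansion_maps(1,2)[OF YY j]
    unfolding pts based_map_def by metis
  let ?AB = "prod_topology (obj A l) (obj B m)"
  define F where "F = f \<circ> map_prod u v"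
  have F: "continuous_map ?AB (polyhedron K) F"
    unfolding F_def map_prod_def
    by (rule continuous_map_compose[OF _ f]) (use u v in \<open>simp add: continuous_map_prod_top\<close>)
  have "homotopic_with (\<lambda>_. True) ?XY (prod_topology (obj XX i) (obj YY j))
      (map_prod u v \<circ> map_prod (a l) (b m)) (map_prod (p i) (q j))"
    using homotopic_with_prod_topology[OF u(2) v(2), of "\<lambda>_. True"] by (simp add: map_prod_def o_def case_prod_unfold)
  from homotopic_with_compose_continuous_map_left[OF this f, of "\<lambda>_. True"]
  have "homotopic_with (\<lambda>_. True) ?XY (polyhedron K) (F \<circ> map_prod (a l) (b m)) (f \<circ> map_prod (p i) (q j))"
    by (simp add: F_def o_assoc)
  with hf have "homotopic_with (\<lambda>_. True) ?XY (polyhedron K) (F \<circ> map_prod (a l) (b m)) (r \<circ> h)"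
    using homotopic_with_trans by blast
  then obtain H where H: "continuous_map (prod_topology I01 ?XY) (polyhedron K) H"
    "\<And>z. H (0, z) = F (map_prod (a l) (b m) z)" "\<And>z. H (1, z) = r (h z)"
    by (auto simp: homotopic_with_def)
  \<comment> \<open>The end of \<open>H\<close> is the map to be factored and stays as it is. Only
    the start is changed, by a map applied after \<open>F\<close>, so it still factors through
    \<open>map_prod (a l) (b m)\<close>.\<close>
  obtain \<kappa> where \<kappa>: "continuous_map (polyhedron K) (polyhedron K) \<kappa>"
    "homotopic_with (\<lambda>k. k (x, y) = H (1, (x, y))) ?XY (polyhedron K) (\<lambda>z. \<kappa> (H (0, z))) (\<lambda>z. H (1, z))"
    using homotopy_end_rel_point[OF NDR_point_polyhedron[OF K(1)] H(1), of "(x, y)"] x y by auto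
  define f' where "f' = r' \<circ> \<kappa> \<circ> F"
  have "based_homotopic ?XY [(x, y)] (polyhedron K) bs (\<kappa> \<circ> F \<circ> map_prod (a l) (b m)) (r \<circ> h)"
    using \<kappa>(2) by (simp add: based_homotopic_def cr(2) H o_def)
  from based_homotopic_compose_left[OF this r(2)]
  have "based_homotopic ?XY [(x, y)] P ps (f' \<circ> map_prod (a l) (b m)) ((r' \<circ> r) \<circ> h)"
    by (simp add: f'_def o_assoc)
  also have "based_homotopic ?XY [(x, y)] P ps ((r' \<circ> r) \<circ> h) h"
    using based_homotopic_compose_right[OF r(3) h] by simp
  finally have fin: "based_homotopic ?XY [(x, y)] P ps (f' \<circ> map_prod (a l) (b m)) h" .
  have "continuous_map ?AB P f'"
    unfolding f'_def using F \<kappa>(1) r(2) by (auto simp: based_map_def intro!: continuous_map_compose)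
  moreover have "pts A l = [a l x]" "pts B m = [b m y]"
    using HPol_expansion_maps(1)[OF A l] HPol_expansion_maps(1)[OF B m] by (auto simp: based_map_def)
  ultimately have "based_map ?AB (zip (pts A l) (pts B m)) P ps f'"
    using based_homotopic_imp_based_map(1)[OF fin] by (simp add: based_map_def)
  with l m fin show thesis
    using that by blast
qed

section \<open>Comultiplication of the sphere\<close>

lemma sphere_base_in_nsphere: "sphere_base \<in> topspace (nsphere k)"
proof -
  have "(\<Sum>i\<le>k. (sphere_base i)\<^sup>2) = (\<Sum>i\<le>k. if i = 0 then 1 else 0 :: real)"
    by (intro sum.cong) (auto simp: sphere_base_def)
  then show ?thesis
    by (simp add: nsphere) (simp add: sphere_base_def)
qed

lemma continuous_map_into_nsphere:
  "continuous_map X (nsphere k) f \<longleftrightarrow>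
     (\<forall>i. continuous_map X euclideanreal (\<lambda>x. f x i)) \<and> f \<in> topspace X \<rightarrow> topspace (nsphere k)"
  unfolding nsphere by (auto simp: continuous_map_in_subtopology continuous_map_componentwise_UNIV)

lemma continuous_map_sphere_pinch:
  assumes "k \<ge> 1"
  shows "continuous_map (nsphere k) (nsphere k) (sphere_pinch k)"
  unfolding continuous_map_into_nsphere
proof (intro conjI allI)
  fix i
  show "continuous_map (nsphere k) euclideanreal (\<lambda>x. sphere_pinch k x i)"
    unfolding sphere_pinch_def
    by (cases "i = 0"; cases "i = k")
      (auto intro!: continuous_intros continuous_map_real_mult continuous_map_real_pow
        continuous_map_nsphere_projection)
qed (use sphere_pinch_in_nsphere[OF assms] in auto)

lemma sphere_pinch_equator: "k \<ge> 1 \<Longrightarrow> x k = 0 \<Longrightarrow> sphere_pinch k x = sphere_base"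
  by (auto simp: sphere_pinch_def sphere_base_def)

text \<open>The sum is formed in the source, so it commutes with postcomposition on the nose;
  bonding maps and induced maps are additive for this reason.\<close>

lemma comp_sphere_add: "u \<circ> sphere_add k f g = sphere_add k (u \<circ> f) (u \<circ> g)"
  by (auto simp: sphere_add_def)

lemma based_homotopic_sphere_add:
  assumes k: "k \<ge> 1"
    and f: "based_homotopic (nsphere k) [sphere_base] Y ys f f'"
    and g: "based_homotopic (nsphere k) [sphere_base] Y ys g g'"
  shows "based_homotopic (nsphere k) [sphere_base] Y ys (sphere_add k f g) (sphere_add k f' g')"
proof -
  let ?S = "nsphere k" and ?IS = "prod_topology I01 (nsphere k)"
  obtain F where F: "continuous_map ?IS Y F" "\<And>x. F (0, x) = f x" "\<And>x. F (1, x) = f' x"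
    "\<And>t. t \<in> {0..1} \<Longrightarrow> [F (t, sphere_base)] = ys"
    using f by (auto simp: based_homotopic_def homotopic_with_def)
  obtain G where G: "continuous_map ?IS Y G" "\<And>x. G (0, x) = g x" "\<And>x. G (1, x) = g' x"
    "\<And>t. t \<in> {0..1} \<Longrightarrow> [G (t, sphere_base)] = ys"
    using g by (auto simp: based_homotopic_def homotopic_with_def)
  define H where "H = (\<lambda>p. if 0 \<le> snd p k then F (fst p, sphere_pinch k (snd p))
                            else G (fst p, sphere_pinch k (snd p)))"
  have fst: "continuous_map ?IS I01 fst" and snd: "continuous_map ?IS ?S snd"
    by (auto simp: continuous_map_fst continuous_map_snd)
  have pinch: "continuous_map ?IS ?S (\<lambda>p. sphere_pinch k (snd p))"
    using continuous_map_compose[OF snd continuous_map_sphere_pinch[OF k]] by (simp add: o_def)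
  have "continuous_map ?IS Y H"
    unfolding H_def
  proof (rule continuous_map_cases_le)
    show "continuous_map ?IS euclideanreal (\<lambda>p. snd p k)"
      using continuous_map_compose[OF snd continuous_map_nsphere_projection] by (simp add: o_def)
    show "continuous_map (subtopology ?IS {p \<in> topspace ?IS. 0 \<le> snd p k}) Y
        (\<lambda>p. F (fst p, sphere_pinch k (snd p)))"
      by (intro continuous_map_from_subtopology continuous_map_pair_compose[OF F(1)] fst pinch)
    show "continuous_map (subtopology ?IS {p \<in> topspace ?IS. snd p k \<le> 0}) Y
        (\<lambda>p. G (fst p, sphere_pinch k (snd p)))"
      by (intro continuous_map_from_subtopology continuous_map_pair_compose[OF G(1)] fst pinch)
    fix p assume "p \<in> topspace ?IS" "0 = snd p k"
    then show "F (fst p, sphere_pinch k (snd p)) = G (fst p, sphere_pinch k (snd p))"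
      using F(4)[of "fst p"] G(4)[of "fst p"] sphere_pinch_equator[OF k, of "snd p"] by auto
  qed auto
  moreover have "[H (t, sphere_base)] = ys" if "t \<in> {0..1}" for t
    using F(4)[OF that] sphere_pinch_equator[OF k, of sphere_base] k
    by (simp add: H_def sphere_base_def)
  ultimately show ?thesis
    unfolding based_homotopic_def homotopic_with_def
    by (intro exI[of _ H]) (auto simp: H_def sphere_add_def F G)
qed

lemma based_map_sphere_add:
  assumes "k \<ge> 1" "based_map (nsphere k) [sphere_base] Y ys f" "based_map (nsphere k) [sphere_base] Y ys g"
  shows "based_map (nsphere k) [sphere_base] Y ys (sphere_add k f g)"
  using based_homotopic_imp_based_map(1) based_homotopic_sphere_add based_homotopic_refl assms by metis

text \<open>With \<open>a = x 0\<close> and \<open>y = x k\<close>, the assumptions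
  \<open>e0\<close> and \<open>ek\<close> say that the coordinates 0 and \<open>k\<close> of
  \<open>w\<close> in \<open>sphere_add_id_base\<close> vanish. The last term of \<open>ek\<close>
  excludes the solution \<open>a = -1\<close>, \<open>y = 0\<close>, \<open>s = 1/2\<close>. For
  \<open>a \<ge> 0\<close> one has \<open>1 - a \<le> y\<close>, because
  \<open>y\<^sup>2 = (1 - a) * (1 + a)\<close>; so \<open>s * y\<close> outweighs the last term
  unless \<open>a = 1\<close>, where \<open>e0\<close> fails. For \<open>a < 0\<close>,
  \<open>ek\<close> makes \<open>2 * (1 - s) * a + s\<close> positive, and multiplication by
  \<open>- a\<close> contradicts \<open>e0\<close>, which on the circle reads
  \<open>(1 - s) * (2 * a\<^sup>2 - 1) = - (s * a)\<close>.\<close>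

lemma unit_law_circle:
  fixes a y s :: real
  assumes ay: "a\<^sup>2 + y\<^sup>2 = 1" and y: "0 \<le> y" and s: "0 < s" "s < 1"
    and e0: "(1 - s) * (1 - 2 * y\<^sup>2) + s * a = 0"
    and ek: "(1 - s) * (2 * y * a) + s * y - s * (1 - s) * (1 - a) = 0"
  shows False
proof (cases "0 \<le> a")
  case True
  have "a\<^sup>2 \<le> 1\<^sup>2"
    using ay zero_le_power2[of y] unfolding power_one by linarith
  then have a1: "a \<le> 1"
    by (rule power2_le_imp_le) simp
  have "(1 - a)\<^sup>2 \<le> y\<^sup>2"
    using ay a1 True mult_nonneg_nonneg[of a "1 - a"] by (simp add: power2_eq_square algebra_simps)
  then have ya: "1 - a \<le> y"
    using y by (rule power2_le_imp_le)
  have "s * (1 - a) \<le> s * y"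
    using ya s by (intro mult_left_mono) auto
  moreover have "0 \<le> (1 - s) * (2 * y * a)"
    using s y True by simp
  ultimately have "s * (1 - a) \<le> s * (1 - s) * (1 - a)"
    using ek by linarith
  then have "s * s * (1 - a) \<le> 0"
    by (simp add: algebra_simps)
  then have "a = 1"
    using s a1 by (simp add: mult_le_0_iff)
  with ay have "y = 0" by simp
  with \<open>a = 1\<close> e0 show False by simp
next
  case False
  then have a: "a < 0" by simp
  have "0 < s * (1 - s) * (1 - a)"
    using s a by simp
  then have "0 < y * (2 * (1 - s) * a + s)"
    using ek by (simp add: algebra_simps)
  then have "0 < 2 * (1 - s) * a + s"
    using y by (simp add: zero_less_mult_iff)
  then have "(- a) * (2 * (1 - s) * a + s) > 0"
    using a by (intro mult_pos_pos) auto
  then have "2 * (1 - s) * a\<^sup>2 < - (s * a)"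
    by (simp add: algebra_simps power2_eq_square)
  moreover have "(1 - s) * (2 * a\<^sup>2 - 1) = - (s * a)"
  proof -
    have "1 - 2 * y\<^sup>2 = 2 * a\<^sup>2 - 1"
      using ay by simp
    then show ?thesis
      using e0 by (simp only:)
  qed
  moreover have "2 * (1 - s) * a\<^sup>2 - (1 - s) * (2 * a\<^sup>2 - 1) = 1 - s"
    by (simp add: algebra_simps)
  ultimately show False
    using s by linarith
qed

text \<open>
  The straight line from \<open>sphere_add k id base\<close> to the identity passes through the origin only over
  \<open>- sphere_base\<close>; the extra term in the \<open>k\<close>-th coordinate moves it away from the origin.
\<close>

lemma sphere_add_id_base:
  assumes k: "k \<ge> 1"
  shows "based_homotopic (nsphere k) [sphere_base] (nsphere k) [sphere_base]
           (sphere_add k id (\<lambda>_. sphere_base)) id"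
proof -
  let ?S = "nsphere k" and ?IS = "prod_topology I01 (nsphere k)"
  define \<rho> where "\<rho> = sphere_add k id (\<lambda>_. sphere_base)"
  have id: "based_map ?S [sphere_base] ?S [sphere_base] id"
    and const: "based_map ?S [sphere_base] ?S [sphere_base] (\<lambda>_. sphere_base)"
    using sphere_base_in_nsphere by (auto simp: based_map_def)
  have \<rho>: "continuous_map ?S ?S \<rho>" and \<rho>b: "\<rho> sphere_base = sphere_base"
    using based_map_sphere_add[OF k id const] by (auto simp: based_map_def \<rho>_def)
  \<comment> \<open>The factor \<open>s * (1 - s)\<close> removes the correction at both ends, and
    \<open>1 - x 0\<close> removes it at \<open>sphere_base\<close>, so the homotopy stays pointed.
    The sign is such that over the lower hemisphere, where \<open>\<rho>\<close> is
    \<open>sphere_base\<close> with \<open>k\<close>-th coordinate 0, the correction reinforces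
    \<open>s * x k < 0\<close>.\<close>
  define w where "w = (\<lambda>(s, x) i. (1 - s) * \<rho> x i + s * x i - (if i = k then s * (1 - s) * (1 - x 0) else 0))"
  define r where "r p = sqrt (\<Sum>i\<le>k. (w p i)\<^sup>2)" for p
  have sphere: "(\<Sum>i\<le>k. (x i)\<^sup>2) = 1" "\<And>i. i > k \<Longrightarrow> x i = 0" if "x \<in> topspace ?S" for x
    using that by (auto simp: nsphere)
  have \<rho>S: "\<rho> x \<in> topspace ?S" if "x \<in> topspace ?S" for x
    using continuous_map_image_subset_topspace[OF \<rho>] that by auto
  have w0: "w (0, x) = \<rho> x" and w1: "w (1, x) = x" for x
    by (auto simp: w_def)
  have wb: "w (s, sphere_base) = sphere_base" for s
  proof
    have "sphere_base 0 = 1"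
      by (simp add: sphere_base_def)
    then show "w (s, sphere_base) i = sphere_base i" for i
      by (simp add: w_def \<rho>b algebra_simps)
  qed
  have not0: "\<exists>i\<le>k. w (s, x) i \<noteq> 0" if s: "s \<in> {0..1}" and x: "x \<in> topspace ?S" for s x
  proof (rule ccontr)
    assume "\<not> ?thesis"
    then have w: "\<And>i. i \<le> k \<Longrightarrow> w (s, x) i = 0"
      by blast
    have "s \<noteq> 0" "s \<noteq> 1"
      using w sphere(1)[OF x] sphere(1)[OF \<rho>S[OF x]] by (auto simp: w0 w1)
    with s have s': "0 < s" "s < 1" by auto
    have sq: "(\<Sum>i\<le>k. (x i)\<^sup>2) = (x 0)\<^sup>2 + (x k)\<^sup>2 + (\<Sum>i\<in>{0<..<k}. (x i)\<^sup>2)"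
    proof -
      have "{..k} = insert 0 (insert k {0<..<k})"
        using k by auto
      then show ?thesis
        using k by simp
    qed
    show False
    proof (cases "0 \<le> x k")
      case True
      \<comment> \<open>Over the upper hemisphere \<open>w\<close> is a positive multiple of
        \<open>x\<close> in the coordinates strictly between 0 and \<open>k\<close>. If these
        vanish, \<open>x\<close> lies on the circle of the coordinates 0 and
        \<open>k\<close>.\<close>
      have wi: "((1 - s) * (2 * x k) + s) * x i = 0" if "i \<in> {0<..<k}" for i
        using w[of i] that True by (simp add: w_def \<rho>_def sphere_add_def sphere_pinch_def algebra_simps)
      have "(1 - s) * (2 * x k) + s > 0"
        using True s' by (simp add: add_nonneg_pos)
      then have "x i = 0" if "i \<in> {0<..<k}" for i
        using wi[OF that] by simp
      then have "(x 0)\<^sup>2 + (x k)\<^sup>2 = 1"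
        using sphere(1)[OF x] sq by simp
      then show False
        using unit_law_circle[of "x 0" "x k" s] True s' w[of 0] w[of k] k
        by (simp add: w_def \<rho>_def sphere_add_def sphere_pinch_def)
    next
      case False
      have "(x 0)\<^sup>2 \<le> 1\<^sup>2"
      proof -
        have "0 \<le> (\<Sum>i\<in>{0<..<k}. (x i)\<^sup>2)"
          by (intro sum_nonneg) auto
        then show ?thesis
          using sphere(1)[OF x] sq zero_le_power2[of "x k"] unfolding power_one by linarith
      qed
      then have "x 0 \<le> 1"
        by (rule power2_le_imp_le) simp
      then have "0 \<le> s * (1 - s) * (1 - x 0)"
        using s' by simp
      moreover have "s * x k < 0"
        using False s' by (simp add: mult_pos_neg)
      moreover have "w (s, x) k = s * x k - s * (1 - s) * (1 - x 0)"
        using False k by (simp add: w_def \<rho>_def sphere_add_def sphere_base_def)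
      ultimately show False
        using w[of k] by linarith
    qed
  qed
  have rpos: "r p > 0" if p: "p \<in> topspace ?IS" for p
  proof -
    have "(\<Sum>i\<le>k. (w p i)\<^sup>2) \<noteq> 0"
      using not0[of "fst p" "snd p"] p by (auto simp: sum_nonneg_eq_0_iff)
    moreover have "(\<Sum>i\<le>k. (w p i)\<^sup>2) \<ge> 0"
      by (intro sum_nonneg) auto
    ultimately show ?thesis
      unfolding r_def by (simp add: less_le)
  qed
  define H where "H p = (\<lambda>i. w p i / r p)" for p
  have r1: "r p = 1" if "w p \<in> topspace ?S" for p
    using sphere(1)[OF that] by (simp add: r_def)
  have snd: "continuous_map ?IS ?S snd" and fst: "continuous_map ?IS euclideanreal fst"
    by (auto simp: continuous_map_snd intro: continuous_map_into_fulltopology[OF continuous_map_fst])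
  have x: "continuous_map ?IS euclideanreal (\<lambda>p. snd p i)" for i
    using continuous_map_compose[OF snd continuous_map_nsphere_projection] by (simp add: o_def)
  have \<rho>x: "continuous_map ?IS euclideanreal (\<lambda>p. \<rho> (snd p) i)" for i
    using continuous_map_compose[OF continuous_map_compose[OF snd \<rho>] continuous_map_nsphere_projection]
    by (simp add: o_def)
  have w: "continuous_map ?IS euclideanreal (\<lambda>p. w p i)" for i
    unfolding w_def case_prod_unfold
    by (cases "i = k") (auto intro!: continuous_intros continuous_map_real_mult fst x \<rho>x)
  have "continuous_map ?IS ?S H"
    unfolding continuous_map_into_nsphere
  proof (intro conjI allI)
    have "continuous_map ?IS euclideanreal (\<lambda>p. \<Sum>i\<le>k. (w p i)\<^sup>2)"
      by (intro continuous_map_sum continuous_map_real_pow w) auto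
    from continuous_map_compose[OF this, of euclideanreal sqrt]
    have "continuous_map ?IS euclideanreal r"
      unfolding r_def by (simp add: o_def continuous_on_real_sqrt)
    then show "continuous_map ?IS euclideanreal (\<lambda>p. H p i)" for i
      unfolding H_def using rpos by (intro continuous_map_real_divide w) (auto simp: less_le)
    show "H \<in> topspace ?IS \<rightarrow> topspace ?S"
    proof
      fix p assume p: "p \<in> topspace ?IS"
      have "(\<Sum>i\<le>k. (H p i)\<^sup>2) = (\<Sum>i\<le>k. (w p i)\<^sup>2) / (r p)\<^sup>2"
        by (simp add: H_def power_divide sum_divide_distrib)
      also have "\<dots> = 1"
      proof -
        have "(r p)\<^sup>2 = (\<Sum>i\<le>k. (w p i)\<^sup>2)"
          unfolding r_def by (intro real_sqrt_pow2 sum_nonneg) auto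
        then show ?thesis
          using rpos[OF p] by (metis divide_self_if less_irrefl power_not_zero)
      qed
      finally have "(\<Sum>i\<le>k. (H p i)\<^sup>2) = 1" .
      moreover have "H p i = 0" if "i > k" for i
        using p that sphere(2)[of "snd p" i] sphere(2)[OF \<rho>S[of "snd p"], of i]
        by (auto simp: H_def w_def case_prod_unfold)
      ultimately show "H p \<in> topspace ?S"
        by (simp add: nsphere)
    qed
  qed
  then show ?thesis
    unfolding based_homotopic_def \<rho>_def[symmetric]
  proof (rule homotopic_withI)
    show "H (0, x) = \<rho> x" if "x \<in> topspace ?S" for x
      using r1[of "(0, x)"] \<rho>S[OF that] by (simp add: H_def w0)
    show "H (1, x) = id x" if "x \<in> topspace ?S" for x
      using r1[of "(1, x)"] that by (simp add: H_def w1)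
    show "map (\<lambda>x. H (t, x)) [sphere_base] = [sphere_base]" for t
      using r1[of "(t, sphere_base)"] sphere_base_in_nsphere by (simp add: H_def wb)
    show "(map h [sphere_base] = [sphere_base]) = (map h' [sphere_base] = [sphere_base])"
      if "\<And>x. x \<in> topspace ?S \<Longrightarrow> h x = h' x" for h h' :: "(nat \<Rightarrow> real) \<Rightarrow> nat \<Rightarrow> real"
      using that sphere_base_in_nsphere by simp
  qed
qed

text \<open>The reflection \<open>J\<close> in the \<open>k\<close>-th coordinate exchanges the
  hemispheres, fixes the base point and commutes with the pinch, so conjugation by it turns one unit
  law into the other. On the equator, which belongs to the first case of \<open>sphere_add\<close>
  on both sides, the pinch gives \<open>sphere_base\<close> anyway.\<close>

lemma sphere_add_base_id:
  assumes k: "k \<ge> 1"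
  shows "based_homotopic (nsphere k) [sphere_base] (nsphere k) [sphere_base]
           (sphere_add k (\<lambda>_. sphere_base) id) id"
proof -
  let ?S = "nsphere k"
  define J :: "(nat \<Rightarrow> real) \<Rightarrow> nat \<Rightarrow> real" where "J x = (\<lambda>i. if i = k then - x i else x i)" for x
  have Jb: "J sphere_base = sphere_base"
    using k by (auto simp: J_def sphere_base_def)
  have "(\<Sum>i\<le>k. (J x i)\<^sup>2) = (\<Sum>i\<le>k. (x i)\<^sup>2)" for x
    by (intro sum.cong) (auto simp: J_def)
  then have "J \<in> topspace ?S \<rightarrow> topspace ?S"
    by (auto simp: nsphere) (simp add: J_def)
  moreover have "continuous_map ?S euclideanreal (\<lambda>x. J x i)" for i
    by (cases "i = k") (auto simp: J_def intro: continuous_intros continuous_map_nsphere_projection)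
  ultimately have J: "based_map ?S [sphere_base] ?S [sphere_base] J"
    by (simp add: based_map_def continuous_map_into_nsphere Jb)
  have JJ: "J \<circ> id \<circ> J = id"
    by (auto simp: J_def fun_eq_iff)
  have "sphere_pinch k (J x) = J (sphere_pinch k x)" for x
    using k by (auto simp: sphere_pinch_def J_def)
  moreover have "J (J x) = x" for x
    by (auto simp: J_def)
  ultimately have "J \<circ> sphere_add k id (\<lambda>_. sphere_base) \<circ> J = sphere_add k (\<lambda>_. sphere_base) id"
    using sphere_pinch_equator[OF k]
    by (auto simp: fun_eq_iff sphere_add_def Jb) (auto simp: J_def)
  moreover have "based_homotopic ?S [sphere_base] ?S [sphere_base]
      (J \<circ> sphere_add k id (\<lambda>_. sphere_base) \<circ> J) (J \<circ> id \<circ> J)"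
    by (intro based_homotopic_compose_right[OF _ J] based_homotopic_compose_left[OF _ J]
        sphere_add_id_base[OF k])
  ultimately show ?thesis
    unfolding JJ by simp
qed

text \<open>The universal case is the identity of the sphere; composing its homotopies with
  \<open>f\<close> gives the general one.\<close>

lemma sphere_add_unit:
  assumes k: "k \<ge> 1" and f: "based_map (nsphere k) [sphere_base] Y ys f"
  shows "based_homotopic (nsphere k) [sphere_base] Y ys (sphere_add k f (\<lambda>_. hd ys)) f"
    and "based_homotopic (nsphere k) [sphere_base] Y ys (sphere_add k (\<lambda>_. hd ys) f) f"
proof -
  have hd: "f sphere_base = hd ys"
    using f by (auto simp: based_map_def)
  show "based_homotopic (nsphere k) [sphere_base] Y ys (sphere_add k f (\<lambda>_. hd ys)) f"
    using based_homotopic_compose_left[OF sphere_add_id_base[OF k] f] by (simp add: comp_sphere_add hd)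
  show "based_homotopic (nsphere k) [sphere_base] Y ys (sphere_add k (\<lambda>_. hd ys) f) f"
    using based_homotopic_compose_left[OF sphere_add_base_id[OF k] f] by (simp add: comp_sphere_add hd)
qed

section \<open>Shape groups and induced homomorphisms\<close>

lemma mem_homotopy_class: "g \<in> homotopy_class Q qs Y ys f \<longleftrightarrow> based_homotopic Q qs Y ys f g"
  by (simp add: homotopy_class_def)

lemma homotopy_class_eqI:
  assumes "based_homotopic Q qs Y ys f g"
  shows "homotopy_class Q qs Y ys f = homotopy_class Q qs Y ys g"
  using assms based_homotopic_sym based_homotopic_trans unfolding homotopy_class_def by blast

lemma shape_morphism_values:
  assumes F: "F \<in> shape_morphisms Q qs S" and i: "i \<in> index S"
  shows "\<exists>f. f \<in> F i"
    and "f \<in> F i \<Longrightarrow> based_map Q qs (obj S i) (pts S i) f"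
    and "f \<in> F i \<Longrightarrow> F i = homotopy_class Q qs (obj S i) (pts S i) f"
    and "f \<in> F i \<Longrightarrow> g \<in> F i \<Longrightarrow> based_homotopic Q qs (obj S i) (pts S i) f g"
proof -
  obtain e where e: "based_map Q qs (obj S i) (pts S i) e"
    and Fi: "F i = homotopy_class Q qs (obj S i) (pts S i) e"
    using assms by (auto simp: shape_morphisms_def PiE_iff)
  show "\<exists>f. f \<in> F i"
    using based_homotopic_refl[OF e] by (auto simp: Fi mem_homotopy_class)
  show fe: "F i = homotopy_class Q qs (obj S i) (pts S i) f" if "f \<in> F i" for f
    using that homotopy_class_eqI unfolding Fi mem_homotopy_class by blast
  show "based_map Q qs (obj S i) (pts S i) f" if "f \<in> F i"
    using that based_homotopic_imp_based_map(2) by (auto simp: Fi mem_homotopy_class)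
  show "based_homotopic Q qs (obj S i) (pts S i) f g" if "f \<in> F i" "g \<in> F i"
    using that(2) unfolding fe[OF that(1)] mem_homotopy_class .
qed

lemma shape_morphism_bond:
  assumes "F \<in> shape_morphisms Q qs S" "i \<in> index S" "j \<in> index S" "leq S i j" "f \<in> F j"
  shows "bond S i j \<circ> f \<in> F i"
  using assms by (auto simp: shape_morphisms_def)

lemma shape_morphismsI:
  assumes "F \<in> extensional (index S)"
    and "\<And>i. i \<in> index S \<Longrightarrow> \<exists>f. based_map Q qs (obj S i) (pts S i) f \<and>
           F i = homotopy_class Q qs (obj S i) (pts S i) f"
    and "\<And>i j f. i \<in> index S \<Longrightarrow> j \<in> index S \<Longrightarrow> leq S i j \<Longrightarrow> f \<in> F j \<Longrightarrow> bond S i j \<circ> f \<in> F i"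
  shows "F \<in> shape_morphisms Q qs S"
proof -
  have "F i \<in> homotopy_class Q qs (obj S i) (pts S i) ` {f. based_map Q qs (obj S i) (pts S i) f}"
    if "i \<in> index S" for i
    using assms(2)[OF that] by blast
  with assms(1,3) show ?thesis
    by (simp add: shape_morphisms_def PiE_iff)
qed

lemma shape_morphisms_eqI:
  assumes "F \<in> shape_morphisms Q qs S" "G \<in> shape_morphisms Q qs S"
    and "\<And>i. i \<in> index S \<Longrightarrow> F i = G i"
  shows "F = G"
proof (rule extensionalityI)
  show "F \<in> extensional (index S)" "G \<in> extensional (index S)"
    using assms(1,2) by (auto simp: shape_morphisms_def PiE_iff)
qed (rule assms(3))

text \<open>Well-definedness of the composite of \<open>F\<close> with a map from \<open>X\<close>
  to \<open>P\<close>, whatever factorization of that map is used. Both factorizations are moved to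
  a common term, where (E2) makes them homotopic after a further bonding map, and are then evaluated
  on a member of that later component of \<open>F\<close>.\<close>

lemma shape_morphism_action_unique:
  fixes P :: "'r topology"
  assumes universe: "(UNIV :: real set) \<lesssim> (UNIV :: 'u set)"
    and S: "HPol_expansion TYPE('u) X xs S p" and P: "HPol TYPE('u) P ps"
    and F: "F \<in> shape_morphisms Q qs S"
    and i: "i \<in> index S" "based_map (obj S i) (pts S i) P ps u" "f \<in> F i"
    and j: "j \<in> index S" "based_map (obj S j) (pts S j) P ps v" "g \<in> F j"
    and uv: "based_homotopic X xs P ps (u \<circ> p i) (v \<circ> p j)"
  shows "based_homotopic Q qs P ps (u \<circ> f) (v \<circ> g)"
proof -
  note maps = HPol_expansion_maps[OF S]
  obtain k where k: "k \<in> index S" "leq S i k" "leq S j k"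
    using maps(5) i(1) j(1) unfolding directed_set_def by blast
  note bi = maps(3)[OF i(1) k(1,2)] and bj = maps(3)[OF j(1) k(1,3)]
  have "based_homotopic X xs P ps ((u \<circ> bond S i k) \<circ> p k) (u \<circ> p i)"
    using based_homotopic_compose_left[OF maps(4)[OF i(1) k(1,2)] i(2)] by (simp add: o_assoc)
  moreover have "based_homotopic X xs P ps ((v \<circ> bond S j k) \<circ> p k) (v \<circ> p j)"
    using based_homotopic_compose_left[OF maps(4)[OF j(1) k(1,3)] j(2)] by (simp add: o_assoc)
  ultimately have "based_homotopic X xs P ps ((u \<circ> bond S i k) \<circ> p k) ((v \<circ> bond S j k) \<circ> p k)"
    using uv based_homotopic_sym based_homotopic_trans by meson
  then obtain l where l: "l \<in> index S" "leq S k l"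
    and h: "based_homotopic (obj S l) (pts S l) P ps (u \<circ> bond S i k \<circ> bond S k l) (v \<circ> bond S j k \<circ> bond S k l)"
    using HPol_expansion_factor_unique[OF universe S P k(1) based_map_compose[OF bi i(2)]
        based_map_compose[OF bj j(2)]] by blast
  obtain e where e: "e \<in> F l"
    using shape_morphism_values(1)[OF F l(1)] by blast
  then have ek: "bond S k l \<circ> e \<in> F k"
    using shape_morphism_bond[OF F k(1) l] by blast
  have "based_homotopic Q qs P ps (u \<circ> (bond S i k \<circ> (bond S k l \<circ> e))) (u \<circ> f)"
    by (intro based_homotopic_compose_left[OF _ i(2)] shape_morphism_values(4)[OF F i(1) _ i(3)]
        shape_morphism_bond[OF F i(1) k(1,2)] ek)
  moreover have "based_homotopic Q qs P ps (v \<circ> (bond S j k \<circ> (bond S k l \<circ> e))) (v \<circ> g)"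
    by (intro based_homotopic_compose_left[OF _ j(2)] shape_morphism_values(4)[OF F j(1) _ j(3)]
        shape_morphism_bond[OF F j(1) k(1,3)] ek)
  moreover have "based_homotopic Q qs P ps (u \<circ> (bond S i k \<circ> (bond S k l \<circ> e))) (v \<circ> (bond S j k \<circ> (bond S k l \<circ> e)))"
    using based_homotopic_compose_right[OF h shape_morphism_values(2)[OF F l(1) e]] by (simp add: o_assoc)
  ultimately show ?thesis
    using based_homotopic_sym based_homotopic_trans by meson
qed

text \<open>The composite of a shape morphism with the map \<open>g\<close>, formed without choices:
  all admissible \<open>u\<close> and \<open>f\<close> yield the same class, so the union of these
  classes is that class.\<close>

definition shape_induced ::
  "'s topology \<Rightarrow> 's list \<Rightarrow> 'a topology \<Rightarrow> 'a list \<Rightarrow> ('i, 'p) inv_sys \<Rightarrow> ('i \<Rightarrow> 'a \<Rightarrow> 'p) \<Rightarrow>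
   ('j, 'q) inv_sys \<Rightarrow> ('j \<Rightarrow> 'b \<Rightarrow> 'q) \<Rightarrow> ('a \<Rightarrow> 'b) \<Rightarrow> ('i \<Rightarrow> ('s \<Rightarrow> 'p) set) \<Rightarrow> 'j \<Rightarrow> ('s \<Rightarrow> 'q) set" where
  "shape_induced Q qs X xs S p T q g F = (\<lambda>j\<in>index T.
     \<Union>{homotopy_class Q qs (obj T j) (pts T j) (u \<circ> f) |i u f. i \<in> index S \<and>
        based_map (obj S i) (pts S i) (obj T j) (pts T j) u \<and>
        based_homotopic X xs (obj T j) (pts T j) (u \<circ> p i) (q j \<circ> g) \<and> f \<in> F i})"

lemma shape_induced_value:
  assumes universe: "(UNIV :: real set) \<lesssim> (UNIV :: 'u set)"
    and S: "HPol_expansion TYPE('u) X xs S p" and T: "HPol_expansion TYPE('u) Y ys T q"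
    and F: "F \<in> shape_morphisms Q qs S" and j: "j \<in> index T"
    and i: "i \<in> index S" and u: "based_map (obj S i) (pts S i) (obj T j) (pts T j) u"
      "based_homotopic X xs (obj T j) (pts T j) (u \<circ> p i) (q j \<circ> g)"
    and f: "f \<in> F i"
  shows "shape_induced Q qs X xs S p T q g F j = homotopy_class Q qs (obj T j) (pts T j) (u \<circ> f)"
    and "u \<circ> f \<in> shape_induced Q qs X xs S p T q g F j"
proof -
  have "homotopy_class Q qs (obj T j) (pts T j) (v \<circ> h) = homotopy_class Q qs (obj T j) (pts T j) (u \<circ> f)"
    if "i' \<in> index S" "based_map (obj S i') (pts S i') (obj T j) (pts T j) v"
      "based_homotopic X xs (obj T j) (pts T j) (v \<circ> p i') (q j \<circ> g)" "h \<in> F i'" for i' v h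
  proof (rule homotopy_class_eqI)
    have "based_homotopic X xs (obj T j) (pts T j) (v \<circ> p i') (u \<circ> p i)"
      using that(3) u(2) based_homotopic_sym based_homotopic_trans by meson
    then show "based_homotopic Q qs (obj T j) (pts T j) (v \<circ> h) (u \<circ> f)"
      using shape_morphism_action_unique[OF universe S HPol_expansion_maps(2)[OF T j] F] that i u(1) f
      by blast
  qed
  then have "{homotopy_class Q qs (obj T j) (pts T j) (v \<circ> h) |i v h. i \<in> index S \<and>
        based_map (obj S i) (pts S i) (obj T j) (pts T j) v \<and>
        based_homotopic X xs (obj T j) (pts T j) (v \<circ> p i) (q j \<circ> g) \<and> h \<in> F i}
      = {homotopy_class Q qs (obj T j) (pts T j) (u \<circ> f)}"
    using i u f by blast
  then show eq: "shape_induced Q qs X xs S p T q g F j = homotopy_class Q qs (obj T j) (pts T j) (u \<circ> f)"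
    using j by (simp add: shape_induced_def)
  show "u \<circ> f \<in> shape_induced Q qs X xs S p T q g F j"
    unfolding eq mem_homotopy_class
    using based_map_compose[OF shape_morphism_values(2)[OF F i f] u(1)] by (rule based_homotopic_refl)
qed

lemma expansion_representative:
  assumes universe: "(UNIV :: real set) \<lesssim> (UNIV :: 'u set)"
    and S: "HPol_expansion TYPE('u) X xs S p" and T: "HPol_expansion TYPE('u) Y ys T q"
    and g: "based_map X xs Y ys g" and j: "j \<in> index T"
  obtains i u where "i \<in> index S" "based_map (obj S i) (pts S i) (obj T j) (pts T j) u"
    "based_homotopic X xs (obj T j) (pts T j) (u \<circ> p i) (q j \<circ> g)"
  using HPol_expansion_factor[OF universe S HPol_expansion_maps(2)[OF T j]
      based_map_compose[OF g HPol_expansion_maps(1)[OF T j]]] .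

lemma shape_induced_closed:
  assumes universe: "(UNIV :: real set) \<lesssim> (UNIV :: 'u set)"
    and S: "HPol_expansion TYPE('u) X xs S p" and T: "HPol_expansion TYPE('u) Y ys T q"
    and g: "based_map X xs Y ys g" and F: "F \<in> shape_morphisms Q qs S"
  shows "shape_induced Q qs X xs S p T q g F \<in> shape_morphisms Q qs T" (is "?G \<in> _")
proof (rule shape_morphismsI)
  show "?G \<in> extensional (index T)"
    by (simp add: shape_induced_def)
  fix j assume j: "j \<in> index T"
  obtain i u where i: "i \<in> index S" and u: "based_map (obj S i) (pts S i) (obj T j) (pts T j) u"
    "based_homotopic X xs (obj T j) (pts T j) (u \<circ> p i) (q j \<circ> g)"
    using expansion_representative[OF universe S T g j] .
  obtain f where f: "f \<in> F i"
    using shape_morphism_values(1)[OF F i] by blast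
  note val = shape_induced_value[OF universe S T F j i u f]
  show "\<exists>f. based_map Q qs (obj T j) (pts T j) f \<and> ?G j = homotopy_class Q qs (obj T j) (pts T j) f"
    using val(1) based_map_compose[OF shape_morphism_values(2)[OF F i f] u(1)] by blast
  fix l h assume l: "l \<in> index T" "leq T l j" and h: "h \<in> ?G j"
  note b = HPol_expansion_maps(3)[OF T l(1) j l(2)]
  have "based_homotopic X xs (obj T l) (pts T l) ((bond T l j \<circ> u) \<circ> p i) ((bond T l j \<circ> q j) \<circ> g)"
    using based_homotopic_compose_left[OF u(2) b] by (simp add: o_assoc)
  also have "based_homotopic X xs (obj T l) (pts T l) ((bond T l j \<circ> q j) \<circ> g) (q l \<circ> g)"
    using based_homotopic_compose_right[OF HPol_expansion_maps(4)[OF T l(1) j l(2)] g] .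
  finally have "?G l = homotopy_class Q qs (obj T l) (pts T l) ((bond T l j \<circ> u) \<circ> f)"
    using shape_induced_value(1)[OF universe S T F l(1) i based_map_compose[OF u(1) b] _ f] by blast
  moreover have "based_homotopic Q qs (obj T l) (pts T l) ((bond T l j \<circ> u) \<circ> f) (bond T l j \<circ> h)"
    using based_homotopic_compose_left[OF _ b] h unfolding val(1) mem_homotopy_class o_assoc[symmetric]
    by blast
  ultimately show "bond T l j \<circ> h \<in> ?G l"
    by (simp add: mem_homotopy_class)
qed

lemma shape_induced_compose:
  assumes universe: "(UNIV :: real set) \<lesssim> (UNIV :: 'u set)"
    and S: "HPol_expansion TYPE('u) X xs S p" and T: "HPol_expansion TYPE('u) Y ys T q"
    and R: "HPol_expansion TYPE('u) Z zs R r"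
    and g: "based_map X xs Y ys g" and h: "based_map Y ys Z zs h" and F: "F \<in> shape_morphisms Q qs S"
  shows "shape_induced Q qs Y ys T q R r h (shape_induced Q qs X xs S p T q g F)
       = shape_induced Q qs X xs S p R r (h \<circ> g) F"
proof (rule shape_morphisms_eqI)
  let ?G = "shape_induced Q qs X xs S p T q g F"
  have G: "?G \<in> shape_morphisms Q qs T"
    by (rule shape_induced_closed[OF universe S T g F])
  then show "shape_induced Q qs Y ys T q R r h ?G \<in> shape_morphisms Q qs R"
    by (rule shape_induced_closed[OF universe T R h])
  show "shape_induced Q qs X xs S p R r (h \<circ> g) F \<in> shape_morphisms Q qs R"
    by (rule shape_induced_closed[OF universe S R based_map_compose[OF g h] F])
  fix k assume k: "k \<in> index R"
  obtain j v where j: "j \<in> index T" and v: "based_map (obj T j) (pts T j) (obj R k) (pts R k) v"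
    "based_homotopic Y ys (obj R k) (pts R k) (v \<circ> q j) (r k \<circ> h)"
    using expansion_representative[OF universe T R h k] .
  obtain i u where i: "i \<in> index S" and u: "based_map (obj S i) (pts S i) (obj T j) (pts T j) u"
    "based_homotopic X xs (obj T j) (pts T j) (u \<circ> p i) (q j \<circ> g)"
    using expansion_representative[OF universe S T g j] .
  obtain f where f: "f \<in> F i"
    using shape_morphism_values(1)[OF F i] by blast
  have "based_homotopic X xs (obj R k) (pts R k) ((v \<circ> u) \<circ> p i) ((v \<circ> q j) \<circ> g)"
    using based_homotopic_compose_left[OF u(2) v(1)] by (simp add: o_assoc)
  also have "based_homotopic X xs (obj R k) (pts R k) ((v \<circ> q j) \<circ> g) (r k \<circ> (h \<circ> g))"
    using based_homotopic_compose_right[OF v(2) g] by (simp add: o_assoc)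
  finally have "shape_induced Q qs X xs S p R r (h \<circ> g) F k
      = homotopy_class Q qs (obj R k) (pts R k) ((v \<circ> u) \<circ> f)"
    using shape_induced_value(1)[OF universe S R F k i based_map_compose[OF u(1) v(1)] _ f] by blast
  moreover have "shape_induced Q qs Y ys T q R r h ?G k = homotopy_class Q qs (obj R k) (pts R k) (v \<circ> (u \<circ> f))"
    using shape_induced_value(1)[OF universe T R G k j v shape_induced_value(2)[OF universe S T F j i u f]] .
  ultimately show "shape_induced Q qs Y ys T q R r h ?G k = shape_induced Q qs X xs S p R r (h \<circ> g) F k"
    by (simp add: o_assoc)
qed

lemma shape_induced_id:
  assumes universe: "(UNIV :: real set) \<lesssim> (UNIV :: 'u set)"
    and S: "HPol_expansion TYPE('u) X xs S p" and F: "F \<in> shape_morphisms Q qs S"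
  shows "shape_induced Q qs X xs S p S p id F = F"
proof (rule shape_morphisms_eqI[OF _ F])
  have "based_map X xs X xs id"
    by (simp add: based_map_def)
  then show "shape_induced Q qs X xs S p S p id F \<in> shape_morphisms Q qs S"
    using shape_induced_closed[OF universe S S _ F] by blast
  fix i assume i: "i \<in> index S"
  obtain f where f: "f \<in> F i"
    using shape_morphism_values(1)[OF F i] by blast
  have "based_map (obj S i) (pts S i) (obj S i) (pts S i) id"
    by (simp add: based_map_def)
  moreover have "based_homotopic X xs (obj S i) (pts S i) (id \<circ> p i) (p i \<circ> id)"
    using based_homotopic_refl[OF HPol_expansion_maps(1)[OF S i]] by simp
  ultimately have "shape_induced Q qs X xs S p S p id F i = homotopy_class Q qs (obj S i) (pts S i) (id \<circ> f)"
    using shape_induced_value(1)[OF universe S S F i i _ _ f] by blast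
  then show "shape_induced Q qs X xs S p S p id F i = F i"
    using shape_morphism_values(3)[OF F i f] by simp
qed

text \<open>Meant for the mixed composites, the projection to one factor after the inclusion of the
  other, which have to be trivial.\<close>

lemma shape_induced_const:
  assumes universe: "(UNIV :: real set) \<lesssim> (UNIV :: 'u set)"
    and S: "HPol_expansion TYPE('u) X [x] S p" and T: "HPol_expansion TYPE('u) Y [y] T q"
    and y: "y \<in> topspace Y" and F: "F \<in> shape_morphisms Q [b] S" and j: "j \<in> index T"
  shows "(\<lambda>_. hd (pts T j)) \<in> shape_induced Q [b] X [x] S p T q (\<lambda>_. y) F j"
proof -
  obtain i where i: "i \<in> index S"
    using HPol_expansion_maps(5)[OF S] by (auto simp: directed_set_def)
  obtain f where f: "f \<in> F i"
    using shape_morphism_values(1)[OF F i] by blast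
  have q: "continuous_map Y (obj T j) (q j)" "pts T j = [q j y]"
    using HPol_expansion_maps(1)[OF T j] by (auto simp: based_map_def)
  have qy: "q j y \<in> topspace (obj T j)"
    using continuous_map_image_subset_topspace[OF q(1)] y by auto
  have "pts S i = [p i x]"
    using HPol_expansion_maps(1)[OF S i] by (auto simp: based_map_def)
  then have u: "based_map (obj S i) (pts S i) (obj T j) (pts T j) (\<lambda>_. q j y)"
    using qy by (simp add: based_map_def q(2))
  have "(\<lambda>_. q j y) \<circ> p i = q j \<circ> (\<lambda>_. y)"
    by auto
  then have "based_homotopic X [x] (obj T j) (pts T j) ((\<lambda>_. q j y) \<circ> p i) (q j \<circ> (\<lambda>_. y))"
    using based_homotopic_refl[OF based_map_compose[OF HPol_expansion_maps(1)[OF S i] u]] by simp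
  from shape_induced_value(2)[OF universe S T F j i u this f] show ?thesis
    by (simp add: q(2) o_def)
qed

section \<open>The group operation and its compatibility with induced maps\<close>

abbreviation sphere_induced where
  "sphere_induced k \<equiv> shape_induced (nsphere k) [sphere_base]"

lemma carrier_shape_group: "carrier (shape_group k S) = shape_morphisms (nsphere k) [sphere_base] S"
  by (simp add: shape_group_def)

lemma shape_group_mult_value:
  assumes k: "k \<ge> 1" and F: "F \<in> carrier (shape_group k S)" and G: "G \<in> carrier (shape_group k S)"
    and i: "i \<in> index S" and f: "f \<in> F i" and g: "g \<in> G i"
  shows "(F \<otimes>\<^bsub>shape_group k S\<^esub> G) i
       = homotopy_class (nsphere k) [sphere_base] (obj S i) (pts S i) (sphere_add k f g)"
    and "sphere_add k f g \<in> (F \<otimes>\<^bsub>shape_group k S\<^esub> G) i"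
proof -
  note F = F[unfolded carrier_shape_group] and G = G[unfolded carrier_shape_group]
  have "homotopy_class (nsphere k) [sphere_base] (obj S i) (pts S i) (sphere_add k f' g')
      = homotopy_class (nsphere k) [sphere_base] (obj S i) (pts S i) (sphere_add k f g)"
    if "f' \<in> F i" "g' \<in> G i" for f' g'
    using shape_morphism_values(4)[OF F i that(1) f] shape_morphism_values(4)[OF G i that(2) g]
    by (intro homotopy_class_eqI based_homotopic_sphere_add[OF k])
  then have "(\<Union>f\<in>F i. \<Union>g\<in>G i. homotopy_class (nsphere k) [sphere_base] (obj S i) (pts S i) (sphere_add k f g))
      = homotopy_class (nsphere k) [sphere_base] (obj S i) (pts S i) (sphere_add k f g)"
    using f g by blast
  then show eq: "(F \<otimes>\<^bsub>shape_group k S\<^esub> G) i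
       = homotopy_class (nsphere k) [sphere_base] (obj S i) (pts S i) (sphere_add k f g)"
    using i by (simp add: shape_group_def)
  show "sphere_add k f g \<in> (F \<otimes>\<^bsub>shape_group k S\<^esub> G) i"
    unfolding eq mem_homotopy_class
    by (intro based_homotopic_refl based_map_sphere_add[OF k] shape_morphism_values(2)[OF F i f]
        shape_morphism_values(2)[OF G i g])
qed

lemma shape_group_mult_closed:
  assumes k: "k \<ge> 1" and S: "HPol_expansion U X xs S p"
    and F: "F \<in> carrier (shape_group k S)" and G: "G \<in> carrier (shape_group k S)"
  shows "F \<otimes>\<^bsub>shape_group k S\<^esub> G \<in> carrier (shape_group k S)" (is "?H \<in> _")
  unfolding carrier_shape_group
proof (rule shape_morphismsI)
  note F' = F[unfolded carrier_shape_group] and G' = G[unfolded carrier_shape_group]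
  show "?H \<in> extensional (index S)"
    by (simp add: shape_group_def)
  fix j assume j: "j \<in> index S"
  obtain f g where f: "f \<in> F j" and g: "g \<in> G j"
    using shape_morphism_values(1)[OF F' j] shape_morphism_values(1)[OF G' j] by blast
  note val = shape_group_mult_value[OF k F G]
  show "\<exists>f. based_map (nsphere k) [sphere_base] (obj S j) (pts S j) f \<and>
      ?H j = homotopy_class (nsphere k) [sphere_base] (obj S j) (pts S j) f"
    using val(1)[OF j f g] based_map_sphere_add[OF k shape_morphism_values(2)[OF F' j f]
        shape_morphism_values(2)[OF G' j g]] by blast
  fix i h assume i: "i \<in> index S" "leq S i j" and h: "h \<in> ?H j"
  have "based_homotopic (nsphere k) [sphere_base] (obj S i) (pts S i)
      (bond S i j \<circ> sphere_add k f g) (bond S i j \<circ> h)"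
    using h based_homotopic_compose_left[OF _ HPol_expansion_maps(3)[OF S i(1) j i(2)]]
    unfolding val(1)[OF j f g] mem_homotopy_class by blast
  then show "bond S i j \<circ> h \<in> ?H i"
    using val(1)[OF i(1) shape_morphism_bond[OF F' i(1) j i(2) f] shape_morphism_bond[OF G' i(1) j i(2) g]]
    by (simp add: mem_homotopy_class comp_sphere_add)
qed

text \<open>The neutral element is characterized by its components containing the constant maps,
  since it will occur as an image under a map induced by a constant and
  \<open>shape_induced_const\<close> delivers it in this form.\<close>

lemma shape_group_mult_unit:
  assumes k: "k \<ge> 1" and S: "HPol_expansion U X xs S p"
    and F: "F \<in> carrier (shape_group k S)" and E: "E \<in> carrier (shape_group k S)"
    and const: "\<And>i. i \<in> index S \<Longrightarrow> (\<lambda>_. hd (pts S i)) \<in> E i"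
  shows "F \<otimes>\<^bsub>shape_group k S\<^esub> E = F" and "E \<otimes>\<^bsub>shape_group k S\<^esub> F = F"
proof -
  note F' = F[unfolded carrier_shape_group]
  have "(F \<otimes>\<^bsub>shape_group k S\<^esub> E) i = F i \<and> (E \<otimes>\<^bsub>shape_group k S\<^esub> F) i = F i" if i: "i \<in> index S" for i
  proof -
    obtain f where f: "f \<in> F i"
      using shape_morphism_values(1)[OF F' i] by blast
    note unit = sphere_add_unit[OF k shape_morphism_values(2)[OF F' i f]]
    show ?thesis
      using shape_group_mult_value(1)[OF k F E i f const[OF i]] homotopy_class_eqI[OF unit(1)]
        shape_group_mult_value(1)[OF k E F i const[OF i] f] homotopy_class_eqI[OF unit(2)]
        shape_morphism_values(3)[OF F' i f] by simp
  qed
  then show "F \<otimes>\<^bsub>shape_group k S\<^esub> E = F" "E \<otimes>\<^bsub>shape_group k S\<^esub> F = F"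
    using shape_group_mult_closed[OF k S F E] shape_group_mult_closed[OF k S E F] F'
    unfolding carrier_shape_group by (blast intro: shape_morphisms_eqI)+
qed

lemma sphere_induced_mult:
  assumes universe: "(UNIV :: real set) \<lesssim> (UNIV :: 'u set)" and k: "k \<ge> 1"
    and S: "HPol_expansion TYPE('u) X xs S p" and T: "HPol_expansion TYPE('u) Y ys T q"
    and g: "based_map X xs Y ys g"
    and F: "F \<in> carrier (shape_group k S)" and G: "G \<in> carrier (shape_group k S)"
  shows "sphere_induced k X xs S p T q g (F \<otimes>\<^bsub>shape_group k S\<^esub> G)
       = sphere_induced k X xs S p T q g F \<otimes>\<^bsub>shape_group k T\<^esub> sphere_induced k X xs S p T q g G"
    (is "?ind (F \<otimes>\<^bsub>_\<^esub> G) = _")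
proof (rule shape_morphisms_eqI)
  note F' = F[unfolded carrier_shape_group] and G' = G[unfolded carrier_shape_group]
  have FG: "F \<otimes>\<^bsub>shape_group k S\<^esub> G \<in> shape_morphisms (nsphere k) [sphere_base] S"
    using shape_group_mult_closed[OF k S F G] by (simp add: carrier_shape_group)
  have indF: "?ind F \<in> carrier (shape_group k T)" and indG: "?ind G \<in> carrier (shape_group k T)"
    using shape_induced_closed[OF universe S T g] F' G' by (auto simp: carrier_shape_group)
  show "?ind (F \<otimes>\<^bsub>shape_group k S\<^esub> G) \<in> shape_morphisms (nsphere k) [sphere_base] T"
    by (rule shape_induced_closed[OF universe S T g FG])
  show "?ind F \<otimes>\<^bsub>shape_group k T\<^esub> ?ind G \<in> shape_morphisms (nsphere k) [sphere_base] T"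
    using shape_group_mult_closed[OF k T indF indG] by (simp add: carrier_shape_group)
  fix j assume j: "j \<in> index T"
  obtain i u where i: "i \<in> index S" and u: "based_map (obj S i) (pts S i) (obj T j) (pts T j) u"
    "based_homotopic X xs (obj T j) (pts T j) (u \<circ> p i) (q j \<circ> g)"
    using expansion_representative[OF universe S T g j] .
  obtain f h where f: "f \<in> F i" and h: "h \<in> G i"
    using shape_morphism_values(1)[OF F' i] shape_morphism_values(1)[OF G' i] by blast
  show "?ind (F \<otimes>\<^bsub>shape_group k S\<^esub> G) j = (?ind F \<otimes>\<^bsub>shape_group k T\<^esub> ?ind G) j"
    using shape_induced_value(1)[OF universe S T FG j i u shape_group_mult_value(2)[OF k F G i f h]]
      shape_group_mult_value(1)[OF k indF indG j shape_induced_value(2)[OF universe S T F' j i u f]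
        shape_induced_value(2)[OF universe S T G' j i u h]]
    by (simp only: comp_sphere_add)
qed

section \<open>The topology of the shape group\<close>

lemma openin_shape_group_topology:
  assumes "i \<in> index S" "F \<in> carrier (shape_group k S)"
  shows "openin (shape_group_topology k S) {G \<in> carrier (shape_group k S). F i = G i}"
  unfolding shape_group_topology_def using assms by (intro topology_generated_by_Basis) blast

lemma topspace_shape_group_topology:
  assumes "index S \<noteq> {}"
  shows "topspace (shape_group_topology k S) = carrier (shape_group k S)"
  using assms unfolding shape_group_topology_def topology_generated_by_topspace by blast

text \<open>Each generating set prescribes a single component, so continuity amounts to every
  component being locally constant.\<close>

lemma continuous_map_into_shape_group:
  assumes "index S \<noteq> {}" and h: "\<And>z. z \<in> topspace T \<Longrightarrow> h z \<in> carrier (shape_group k S)"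
    and local: "\<And>z i. z \<in> topspace T \<Longrightarrow> i \<in> index S \<Longrightarrow>
      \<exists>V. openin T V \<and> z \<in> V \<and> (\<forall>z'\<in>V. h z' i = h z i)"
  shows "continuous_map T (shape_group_topology k S) h"
  unfolding shape_group_topology_def
proof (rule continuous_on_generated_topo)
  fix W assume "W \<in> {{G \<in> carrier (shape_group k S). F i = G i} |i F.
          i \<in> index S \<and> F \<in> carrier (shape_group k S)}"
  then obtain i F where i: "i \<in> index S" and W: "W = {G \<in> carrier (shape_group k S). F i = G i}"
    by blast
  show "openin T (h -` W \<inter> topspace T)"
  proof (subst openin_subopen, intro ballI)
    fix z assume z: "z \<in> h -` W \<inter> topspace T"
    then obtain V where V: "openin T V" "z \<in> V" and hV: "\<forall>z'\<in>V. h z' i = h z i"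
      using local[OF _ i] by blast
    have "z' \<in> h -` W \<inter> topspace T" if "z' \<in> V" for z'
    proof -
      have "z' \<in> topspace T"
        using openin_subset[OF V(1)] that by blast
      moreover have "F i = h z' i"
        using bspec[OF hV that] z by (simp add: W)
      ultimately show ?thesis
        using h by (simp add: W)
    qed
    with V show "\<exists>V. openin T V \<and> z \<in> V \<and> V \<subseteq> h -` W \<inter> topspace T"
      by blast
  qed
qed (use assms(1) h in blast)

lemma continuous_map_sphere_induced:
  assumes universe: "(UNIV :: real set) \<lesssim> (UNIV :: 'u set)"
    and S: "HPol_expansion TYPE('u) X xs S p" and T: "HPol_expansion TYPE('u) Y ys T q"
    and g: "based_map X xs Y ys g"
  shows "continuous_map (shape_group_topology k S) (shape_group_topology k T)
           (sphere_induced k X xs S p T q g)"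
proof (rule continuous_map_into_shape_group)
  have "index S \<noteq> {}"
    using HPol_expansion_maps(5)[OF S] by (simp add: directed_set_def)
  then have top: "topspace (shape_group_topology k S) = shape_morphisms (nsphere k) [sphere_base] S"
    using topspace_shape_group_topology carrier_shape_group by metis
  show "index T \<noteq> {}"
    using HPol_expansion_maps(5)[OF T] by (simp add: directed_set_def)
  show "sphere_induced k X xs S p T q g F \<in> carrier (shape_group k T)"
    if "F \<in> topspace (shape_group_topology k S)" for F
    using shape_induced_closed[OF universe S T g] that by (simp add: top carrier_shape_group)
  fix F j assume F: "F \<in> topspace (shape_group_topology k S)" and j: "j \<in> index T"
  obtain i u where i: "i \<in> index S" and u: "based_map (obj S i) (pts S i) (obj T j) (pts T j) u"
    "based_homotopic X xs (obj T j) (pts T j) (u \<circ> p i) (q j \<circ> g)"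
    using expansion_representative[OF universe S T g j] .
  have F: "F \<in> shape_morphisms (nsphere k) [sphere_base] S"
    using F top by simp
  then obtain f where f: "f \<in> F i"
    using shape_morphism_values(1)[OF _ i] by blast
  \<comment> \<open>The \<open>j\<close>-th component of the image depends only on the
    \<open>i\<close>-th component of the argument, so fixing the latter gives the
    neighbourhood.\<close>
  let ?V = "{G \<in> carrier (shape_group k S). F i = G i}"
  have "sphere_induced k X xs S p T q g G j = sphere_induced k X xs S p T q g F j" if "G \<in> ?V" for G
    using that f shape_induced_value(1)[OF universe S T _ j i u, of _ "nsphere k" "[sphere_base]" f] F
    by (simp add: carrier_shape_group)
  moreover have "openin (shape_group_topology k S) ?V" "F \<in> ?V"
    using F openin_shape_group_topology[OF i] by (simp_all add: carrier_shape_group)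
  ultimately show "\<exists>V. openin (shape_group_topology k S) V \<and> F \<in> V \<and>
      (\<forall>G\<in>V. sphere_induced k X xs S p T q g G j = sphere_induced k X xs S p T q g F j)"
    by blast
qed

section \<open>Products\<close>

lemma map_zip_pair: "map (\<lambda>s. (g s, h s)) qs = zip (map g qs) (map h qs)"
  by (induction qs) auto

lemma based_homotopic_pair:
  assumes "based_homotopic Q qs A as g g'" "based_homotopic Q qs B bs h h'"
  shows "based_homotopic Q qs (prod_topology A B) (zip as bs) (\<lambda>s. (g s, h s)) (\<lambda>s. (g' s, h' s))"
proof -
  obtain G where G: "continuous_map (prod_topology I01 Q) A G" "\<And>s. G (0, s) = g s" "\<And>s. G (1, s) = g' s"
    "\<And>t. t \<in> {0..1} \<Longrightarrow> map (\<lambda>s. G (t, s)) qs = as"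
    using assms(1) by (auto simp: based_homotopic_def homotopic_with_def)
  obtain H where H: "continuous_map (prod_topology I01 Q) B H" "\<And>s. H (0, s) = h s" "\<And>s. H (1, s) = h' s"
    "\<And>t. t \<in> {0..1} \<Longrightarrow> map (\<lambda>s. H (t, s)) qs = bs"
    using assms(2) by (auto simp: based_homotopic_def homotopic_with_def)
  show ?thesis
    unfolding based_homotopic_def homotopic_with_def
    by (intro exI[of _ "\<lambda>z. (G z, H z)"]) (simp add: G H map_zip_pair continuous_map_pairedI)
qed

text \<open>
  \<open>c n\<close> factors through \<open>a l \<times> b m\<close>, and \<open>a l \<circ> fst\<close> and \<open>b m \<circ> snd\<close> factor through a common later
  term of the expansion \<open>c\<close>.
\<close>

lemma shape_morphism_of_projections:
  assumes universe: "(UNIV :: real set) \<lesssim> (UNIV :: 'u set)"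
    and XX: "HPol_expansion TYPE('u) X [] XX p" and YY: "HPol_expansion TYPE('u) Y [] YY q"
    and XY: "HPol_expansion TYPE('u) (prod_topology X Y) [] (prod_sys XX YY) (prod_pro_map p q)"
    and x: "x \<in> topspace X" and y: "y \<in> topspace Y"
    and A: "HPol_expansion TYPE('u) X [x] A a" and B: "HPol_expansion TYPE('u) Y [y] B b"
    and C: "HPol_expansion TYPE('u) (prod_topology X Y) [(x, y)] C c"
    and n: "n \<in> index C"
  obtains l m w where "l \<in> index A" "m \<in> index B"
    "\<forall>F\<in>shape_morphisms Q qs C.
       \<forall>g\<in>shape_induced Q qs (prod_topology X Y) [(x, y)] C c A a fst F l.
       \<forall>h\<in>shape_induced Q qs (prod_topology X Y) [(x, y)] C c B b snd F m.
       F n = homotopy_class Q qs (obj C n) (pts C n) (w \<circ> (\<lambda>s. (g s, h s)))"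
proof -
  let ?XY = "prod_topology X Y"
  note Cmaps = HPol_expansion_maps[OF C]
  obtain l m w where l: "l \<in> index A" and m: "m \<in> index B"
    and w: "based_map (prod_topology (obj A l) (obj B m)) (zip (pts A l) (pts B m)) (obj C n) (pts C n) w"
      "based_homotopic ?XY [(x, y)] (obj C n) (pts C n) (w \<circ> map_prod (a l) (b m)) (c n)"
    using pointed_product_factor[OF universe XX YY XY x y A B Cmaps(2)[OF n] Cmaps(1)[OF n]] .
  have fst: "based_map ?XY [(x, y)] X [x] fst" and snd: "based_map ?XY [(x, y)] Y [y] snd"
    by (auto simp: based_map_def continuous_map_fst continuous_map_snd)
  obtain i u where i: "i \<in> index C" and u: "based_map (obj C i) (pts C i) (obj A l) (pts A l) u"
    "based_homotopic ?XY [(x, y)] (obj A l) (pts A l) (u \<circ> c i) (a l \<circ> fst)"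
    using expansion_representative[OF universe C A fst l] .
  obtain j v where j: "j \<in> index C" and v: "based_map (obj C j) (pts C j) (obj B m) (pts B m) v"
    "based_homotopic ?XY [(x, y)] (obj B m) (pts B m) (v \<circ> c j) (b m \<circ> snd)"
    using expansion_representative[OF universe C B snd m] .
  obtain d where d: "d \<in> index C" "leq C i d" "leq C j d"
    using Cmaps(5) i j unfolding directed_set_def by blast
  define u' v' where "u' = u \<circ> bond C i d" and "v' = v \<circ> bond C j d"
  have u': "based_map (obj C d) (pts C d) (obj A l) (pts A l) u'"
    unfolding u'_def by (rule based_map_compose[OF Cmaps(3)[OF i d(1,2)] u(1)])
  have v': "based_map (obj C d) (pts C d) (obj B m) (pts B m) v'"
    unfolding v'_def by (rule based_map_compose[OF Cmaps(3)[OF j d(1,3)] v(1)])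
  have u'c: "based_homotopic ?XY [(x, y)] (obj A l) (pts A l) (u' \<circ> c d) (a l \<circ> fst)"
  proof -
    have "based_homotopic ?XY [(x, y)] (obj A l) (pts A l) (u \<circ> (bond C i d \<circ> c d)) (u \<circ> c i)"
      by (rule based_homotopic_compose_left[OF Cmaps(4)[OF i d(1,2)] u(1)])
    from based_homotopic_trans[OF this u(2)] show ?thesis
      by (simp add: u'_def o_assoc)
  qed
  have v'c: "based_homotopic ?XY [(x, y)] (obj B m) (pts B m) (v' \<circ> c d) (b m \<circ> snd)"
  proof -
    have "based_homotopic ?XY [(x, y)] (obj B m) (pts B m) (v \<circ> (bond C j d \<circ> c d)) (v \<circ> c j)"
      by (rule based_homotopic_compose_left[OF Cmaps(4)[OF j d(1,3)] v(1)])
    from based_homotopic_trans[OF this v(2)] show ?thesis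
      by (simp add: v'_def o_assoc)
  qed
  \<comment> \<open>\<open>W \<circ> c d\<close> is homotopic to \<open>c n\<close>, so uniqueness
    of the action, applied to \<open>W\<close> on term \<open>d\<close> and \<open>id\<close> on
    term \<open>n\<close>, shows that \<open>W\<close> carries \<open>F d\<close> into
    \<open>F n\<close>. At the same time \<open>W\<close> is built from \<open>u'\<close> and
    \<open>v'\<close>, which compute the projections of \<open>F\<close>.\<close>
  define W where "W = w \<circ> (\<lambda>z. (u' z, v' z))"
  have "based_map (obj C d) (pts C d) (prod_topology (obj A l) (obj B m)) (zip (pts A l) (pts B m)) (\<lambda>z. (u' z, v' z))"
    using u' v' by (simp add: based_map_def map_zip_pair continuous_map_pairedI)
  then have W: "based_map (obj C d) (pts C d) (obj C n) (pts C n) W"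
    unfolding W_def using w(1) by (rule based_map_compose)
  have "based_homotopic ?XY [(x, y)] (obj C n) (pts C n) (W \<circ> c d) (w \<circ> map_prod (a l) (b m))"
    using based_homotopic_compose_left[OF based_homotopic_pair[OF u'c v'c] w(1)]
    by (simp add: W_def o_def map_prod_def case_prod_unfold)
  then have Wc: "based_homotopic ?XY [(x, y)] (obj C n) (pts C n) (W \<circ> c d) (id \<circ> c n)"
    using w(2) based_homotopic_trans by fastforce
  have id: "based_map (obj C n) (pts C n) (obj C n) (pts C n) id"
    by (simp add: based_map_def)
  have "F n = homotopy_class Q qs (obj C n) (pts C n) (w \<circ> (\<lambda>s. (g s, h s)))"
    if F: "F \<in> shape_morphisms Q qs C"
      and g: "g \<in> shape_induced Q qs ?XY [(x, y)] C c A a fst F l"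
      and h: "h \<in> shape_induced Q qs ?XY [(x, y)] C c B b snd F m" for F g h
  proof -
    obtain e f where e: "e \<in> F d" and f: "f \<in> F n"
      using shape_morphism_values(1)[OF F d(1)] shape_morphism_values(1)[OF F n] by blast
    have "based_homotopic Q qs (obj A l) (pts A l) (u' \<circ> e) g"
      using shape_induced_value(1)[OF universe C A F l d(1) u' u'c e] g by (simp add: mem_homotopy_class)
    moreover have "based_homotopic Q qs (obj B m) (pts B m) (v' \<circ> e) h"
      using shape_induced_value(1)[OF universe C B F m d(1) v' v'c e] h by (simp add: mem_homotopy_class)
    ultimately have "based_homotopic Q qs (obj C n) (pts C n) (W \<circ> e) (w \<circ> (\<lambda>s. (g s, h s)))"
      using based_homotopic_compose_left[OF based_homotopic_pair w(1)] by (fastforce simp: W_def o_def)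
    moreover have "based_homotopic Q qs (obj C n) (pts C n) (W \<circ> e) f"
      using shape_morphism_action_unique[OF universe C Cmaps(2)[OF n] F d(1) W e n id f Wc] by (simp only: id_comp)
    ultimately have "based_homotopic Q qs (obj C n) (pts C n) f (w \<circ> (\<lambda>s. (g s, h s)))"
      using based_homotopic_sym based_homotopic_trans by meson
    then show ?thesis
      using shape_morphism_values(3)[OF F n f] homotopy_class_eqI by metis
  qed
  then show thesis
    using that[OF l m] by blast
qed

theorem theorem4p1:
  fixes X Y :: "'u topology"
    and XX :: "('i, 'p) inv_sys" and p :: "'i \<Rightarrow> 'u \<Rightarrow> 'p"
    and YY :: "('j, 'q) inv_sys" and q :: "'j \<Rightarrow> 'u \<Rightarrow> 'q"
    and A :: "('l, 'r) inv_sys" and a :: "'l \<Rightarrow> 'u \<Rightarrow> 'r"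
    and B :: "('m, 's) inv_sys" and b :: "'m \<Rightarrow> 'u \<Rightarrow> 's"
    and C :: "('n, 't) inv_sys" and c :: "'n \<Rightarrow> 'u \<times> 'u \<Rightarrow> 't"
    and x y :: 'u and k :: nat
  assumes universe: "(UNIV :: real set) \<lesssim> (UNIV :: 'u set)"
    and "shape_path_connected X" and "shape_path_connected Y"
    and "HPol_expansion TYPE('u) X [] XX p"
    and "HPol_expansion TYPE('u) Y [] YY q"
    and "HPol_expansion TYPE('u) (prod_topology X Y) [] (prod_sys XX YY) (prod_pro_map p q)"
    and "k \<ge> 1" and "x \<in> topspace X" and "y \<in> topspace Y"
    and "HPol_expansion TYPE('u) X [x] A a"
    and "HPol_expansion TYPE('u) Y [y] B b"
    and "HPol_expansion TYPE('u) (prod_topology X Y) [(x, y)] C c"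
  shows "topological_group_isomorphic
           (shape_group k C) (shape_group_topology k C)
           (shape_group k A \<times>\<times> shape_group k B)
           (prod_topology (shape_group_topology k A) (shape_group_topology k B))"
proof -
  note XX = assms(4) and YY = assms(5) and XY = assms(6) and k = assms(7) and x = assms(8)
    and y = assms(9) and A = assms(10) and B = assms(11) and C = assms(12)
  let ?XY = "prod_topology X Y"
  have fst: "based_map ?XY [(x, y)] X [x] fst" and snd: "based_map ?XY [(x, y)] Y [y] snd"
    by (auto simp: based_map_def continuous_map_fst continuous_map_snd)
  have inl: "based_map X [x] ?XY [(x, y)] (\<lambda>t. (t, y))" and inr: "based_map Y [y] ?XY [(x, y)] (\<lambda>t. (x, t))"
    using x y by (auto simp: based_map_def continuous_map_pairedI)
  let ?A = "shape_group k A" and ?B = "shape_group k B" and ?C = "shape_group k C"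
  let ?TA = "shape_group_topology k A" and ?TB = "shape_group_topology k B"
    and ?TC = "shape_group_topology k C"
  define prl where "prl = sphere_induced k ?XY [(x, y)] C c A a fst"
  define prr where "prr = sphere_induced k ?XY [(x, y)] C c B b snd"
  define inL where "inL = sphere_induced k X [x] A a C c (\<lambda>t. (t, y))"
  define inR where "inR = sphere_induced k Y [y] B b C c (\<lambda>t. (x, t))"
  have nonempty: "index A \<noteq> {}" "index B \<noteq> {}" "index C \<noteq> {}"
    using HPol_expansion_maps(5)[OF A] HPol_expansion_maps(5)[OF B] HPol_expansion_maps(5)[OF C]
    by (auto simp: directed_set_def)
  have prl: "prl F \<in> carrier ?A" and prr: "prr F \<in> carrier ?B" if "F \<in> carrier ?C" for F
    using shape_induced_closed[OF universe C A fst] shape_induced_closed[OF universe C B snd] that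
    by (auto simp: prl_def prr_def carrier_shape_group)
  have inL: "inL G \<in> carrier ?C" if "G \<in> carrier ?A" for G
    using shape_induced_closed[OF universe A C inl] that by (simp add: inL_def carrier_shape_group)
  have inR: "inR H \<in> carrier ?C" if "H \<in> carrier ?B" for H
    using shape_induced_closed[OF universe B C inr] that by (simp add: inR_def carrier_shape_group)
  have closed: "inL G \<otimes>\<^bsub>?C\<^esub> inR H \<in> carrier ?C" if "G \<in> carrier ?A" "H \<in> carrier ?B" for G H
    using that inL inR by (intro shape_group_mult_closed[OF k C])

  \<comment> \<open>\<open>l\<close> and \<open>m\<close> depend on \<open>n\<close> alone and not
    on \<open>F\<close>. This uniformity gives injectivity and, later, the continuity of the
    inverse.\<close>
  have determined: "\<exists>l\<in>index A. \<exists>m\<in>index B. \<forall>F\<in>carrier ?C. \<forall>F'\<in>carrier ?C.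
      prl F l = prl F' l \<and> prr F m = prr F' m \<longrightarrow> F n = F' n" if n: "n \<in> index C" for n
  proof -
    obtain l m w where l: "l \<in> index A" and m: "m \<in> index B" and w:
      "\<forall>F\<in>carrier ?C. \<forall>g\<in>prl F l. \<forall>h\<in>prr F m.
         F n = homotopy_class (nsphere k) [sphere_base] (obj C n) (pts C n) (w \<circ> (\<lambda>s. (g s, h s)))"
      unfolding prl_def prr_def carrier_shape_group
      using shape_morphism_of_projections[OF universe XX YY XY x y A B C n] by blast
    have "F n = F' n" if F: "F \<in> carrier ?C" "F' \<in> carrier ?C"
      and eq: "prl F l = prl F' l" "prr F m = prr F' m" for F F'
    proof -
      obtain g h where g: "g \<in> prl F l" and h: "h \<in> prr F m"
        using shape_morphism_values(1)[OF prl[OF F(1), unfolded carrier_shape_group] l]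
          shape_morphism_values(1)[OF prr[OF F(1), unfolded carrier_shape_group] m] by blast
      have "F n = homotopy_class (nsphere k) [sphere_base] (obj C n) (pts C n) (w \<circ> (\<lambda>s. (g s, h s)))"
        using bspec[OF bspec[OF bspec[OF w F(1)] g] h] .
      moreover have "F' n = homotopy_class (nsphere k) [sphere_base] (obj C n) (pts C n) (w \<circ> (\<lambda>s. (g s, h s)))"
        using bspec[OF bspec[OF bspec[OF w F(2)] g[unfolded eq]] h[unfolded eq]] .
      ultimately show ?thesis
        by simp
    qed
    then show ?thesis
      by (intro bexI[OF _ l] bexI[OF _ m] ballI impI) (elim conjE)
  qed
  have inj: "F = F'" if F: "F \<in> carrier ?C" "F' \<in> carrier ?C" "prl F = prl F'" "prr F = prr F'" for F F'
  proof (rule shape_morphisms_eqI)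
    fix n assume "n \<in> index C"
    from determined[OF this] F show "F n = F' n"
      by metis
  qed (use F in \<open>auto simp: carrier_shape_group\<close>)

  have proj: "prl (inL G \<otimes>\<^bsub>?C\<^esub> inR H) = G \<and> prr (inL G \<otimes>\<^bsub>?C\<^esub> inR H) = H"
    if G: "G \<in> carrier ?A" and H: "H \<in> carrier ?B" for G H
  proof -
    note G' = G[unfolded carrier_shape_group] and H' = H[unfolded carrier_shape_group]
    \<comment> \<open>By functoriality the four composites of inclusions and projections are induced
      by identities and constant maps.\<close>
    have o: "fst \<circ> (\<lambda>t. (t, y)) = id" "snd \<circ> (\<lambda>t. (x, t)) = id"
      "snd \<circ> (\<lambda>t. (t, y)) = (\<lambda>_. y)" "fst \<circ> (\<lambda>t. (x, t)) = (\<lambda>_. x)"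
      by auto
    have "prl (inL G) = G"
      unfolding prl_def inL_def shape_induced_compose[OF universe A C A inl fst G'] o
      by (rule shape_induced_id[OF universe A G'])
    moreover have "(\<lambda>_. hd (pts A l)) \<in> prl (inR H) l" if "l \<in> index A" for l
      unfolding prl_def inR_def shape_induced_compose[OF universe B C A inr fst H'] o
      by (rule shape_induced_const[OF universe B A x H' that])
    ultimately have l: "prl (inL G) \<otimes>\<^bsub>?A\<^esub> prl (inR H) = G"
      using shape_group_mult_unit(1)[OF k A G prl[OF inR[OF H]]] by simp
    have "prr (inR H) = H"
      unfolding prr_def inR_def shape_induced_compose[OF universe B C B inr snd H'] o
      by (rule shape_induced_id[OF universe B H'])
    moreover have "(\<lambda>_. hd (pts B m)) \<in> prr (inL G) m" if "m \<in> index B" for m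
      unfolding prr_def inL_def shape_induced_compose[OF universe A C B inl snd G'] o
      by (rule shape_induced_const[OF universe A B y G' that])
    ultimately have r: "prr (inL G) \<otimes>\<^bsub>?B\<^esub> prr (inR H) = H"
      using shape_group_mult_unit(2)[OF k B H prr[OF inL[OF G]]] by simp
    show ?thesis
      using sphere_induced_mult[OF universe k C A fst inL[OF G] inR[OF H]]
        sphere_induced_mult[OF universe k C B snd inL[OF G] inR[OF H]] l r
      by (simp add: prl_def prr_def)
  qed

  define \<phi> where "\<phi> F = (prl F, prr F)" for F
  define \<psi> where "\<psi> = (\<lambda>(G, H). inL G \<otimes>\<^bsub>?C\<^esub> inR H)"
  have \<phi>\<psi>: "\<phi> (\<psi> (G, H)) = (G, H)" if "G \<in> carrier ?A" "H \<in> carrier ?B" for G H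
    using proj[OF that] by (simp add: \<phi>_def \<psi>_def)
  \<comment> \<open>\<open>F\<close> and \<open>\<psi> (\<phi> F)\<close> have the same projections
    by \<open>proj\<close>, so they agree by injectivity.\<close>
  have \<psi>\<phi>: "\<psi> (\<phi> F) = F" if "F \<in> carrier ?C" for F
    using proj[OF prl[OF that] prr[OF that]] closed[OF prl[OF that] prr[OF that]] that
    by (intro inj) (auto simp: \<phi>_def \<psi>_def)
  have "\<phi> \<in> iso ?C (?A \<times>\<times> ?B)"
    unfolding iso_def
  proof (intro CollectI conjI homI)
    show "\<phi> F \<in> carrier (?A \<times>\<times> ?B)" if "F \<in> carrier ?C" for F
      using prl[OF that] prr[OF that] by (simp add: \<phi>_def)
    show "\<phi> (F \<otimes>\<^bsub>?C\<^esub> F') = \<phi> F \<otimes>\<^bsub>?A \<times>\<times> ?B\<^esub> \<phi> F'"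
      if "F \<in> carrier ?C" "F' \<in> carrier ?C" for F F'
      using sphere_induced_mult[OF universe k C A fst that] sphere_induced_mult[OF universe k C B snd that]
      by (simp add: \<phi>_def prl_def prr_def)
    show "bij_betw \<phi> (carrier ?C) (carrier (?A \<times>\<times> ?B))"
    proof (rule bij_betw_byWitness[where f' = \<psi>])
      show "\<forall>F\<in>carrier ?C. \<psi> (\<phi> F) = F"
        using \<psi>\<phi> by blast
      show "\<forall>z\<in>carrier (?A \<times>\<times> ?B). \<phi> (\<psi> z) = z"
        using \<phi>\<psi> by auto
      show "\<phi> ` carrier ?C \<subseteq> carrier (?A \<times>\<times> ?B)"
        using prl prr by (auto simp: \<phi>_def)
      show "\<psi> ` carrier (?A \<times>\<times> ?B) \<subseteq> carrier ?C"
        using closed by (auto simp: \<psi>_def)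
    qed
  qed
  moreover have "homeomorphic_map ?TC (prod_topology ?TA ?TB) \<phi>"
  proof -
    note top = topspace_shape_group_topology[OF nonempty(1)] topspace_shape_group_topology[OF nonempty(2)]
      topspace_shape_group_topology[OF nonempty(3)]
    have "continuous_map ?TC (prod_topology ?TA ?TB) \<phi>"
      unfolding \<phi>_def prl_def prr_def
      by (intro continuous_map_pairedI continuous_map_sphere_induced[OF universe C A fst]
          continuous_map_sphere_induced[OF universe C B snd])
    moreover have "continuous_map (prod_topology ?TA ?TB) ?TC \<psi>"
    proof (rule continuous_map_into_shape_group[OF nonempty(3)])
      show "\<psi> z \<in> carrier ?C" if "z \<in> topspace (prod_topology ?TA ?TB)" for z
        using that closed by (auto simp: \<psi>_def top)
      fix z n assume z: "z \<in> topspace (prod_topology ?TA ?TB)" and n: "n \<in> index C"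
      obtain G H where GH: "z = (G, H)" "G \<in> carrier ?A" "H \<in> carrier ?B"
        using z by (auto simp: top)
      obtain l m where l: "l \<in> index A" and m: "m \<in> index B" and lm:
        "\<forall>F\<in>carrier ?C. \<forall>F'\<in>carrier ?C. prl F l = prl F' l \<and> prr F m = prr F' m \<longrightarrow> F n = F' n"
        using determined[OF n] by (elim bexE) (rule that)
      \<comment> \<open>By \<open>proj\<close> the projections of \<open>\<psi> z'\<close> are the
        two entries of \<open>z'\<close>; freezing component \<open>l\<close> of the first and
        component \<open>m\<close> of the second therefore freezes component \<open>n\<close> of
        \<open>\<psi> z'\<close>.\<close>
      let ?V = "{G' \<in> carrier ?A. G l = G' l} \<times> {H' \<in> carrier ?B. H m = H' m}"
      have "openin (prod_topology ?TA ?TB) ?V"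
        using openin_shape_group_topology[OF l GH(2)] openin_shape_group_topology[OF m GH(3)]
        by (simp add: openin_prod_Times_iff)
      moreover have "z \<in> ?V"
        using GH by simp
      moreover have "\<psi> z' n = \<psi> z n" if z'V: "z' \<in> ?V" for z'
      proof -
        obtain G' H' where z': "z' = (G', H')" "G' \<in> carrier ?A" "H' \<in> carrier ?B"
          "G l = G' l" "H m = H' m"
          using z'V by (cases z') auto
        show ?thesis
          using bspec[OF bspec[OF lm closed[OF z'(2,3)]] closed[OF GH(2,3)]]
            proj[OF z'(2,3)] proj[OF GH(2,3)] z' GH(1) by (simp add: \<psi>_def)
      qed
      ultimately show "\<exists>V. openin (prod_topology ?TA ?TB) V \<and> z \<in> V \<and> (\<forall>z'\<in>V. \<psi> z' n = \<psi> z n)"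
        by blast
    qed
    ultimately have "homeomorphic_maps ?TC (prod_topology ?TA ?TB) \<phi> \<psi>"
      using \<psi>\<phi> \<phi>\<psi> by (auto simp: homeomorphic_maps_def top)
    then show ?thesis
      by (rule homeomorphic_maps_imp_map)
  qed
  ultimately show ?thesis
    unfolding topological_group_isomorphic_def by blast
qed

end
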